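(* Consider the seven families of $4$-dimensional metric Lie algebras (1)-(7) described in the context. Then the metric Lie algebras in these families are pairwise non-equivalent (both for different families and for different values of the parameters within the same family). Moreover, given one of these metric Lie algebras, any non-zero parallel skew-symmetric endomorphism on it is equivalent to exactly one of the following endomorphisms, where in cases (1)-(4) $H_{a_1,a_2}$ denotes the endomorphism $e_i\mapsto a_if_i$, $f_i\mapsto-a_ie_i$ ($i=1,2$): (1) $\mathbb{R}\times\mathfrak{e}(2)$: $H_{a_1,a_2}$ with $a_1,a_2\ge0$; (2) $\mathbb{R}^2\times\mathfrak{aff}(\mathbb{R})$: $H_{a_1,a_2}$ with $a_1,a_2\ge0$; (3) $\mathfrak{r}'_{4,\lambda,0}$: $H_{a_1,a_2}$ with $a_1\ge0$, $a_2\in\mathbb{R}$; (4) $\mathfrak{aff}(\mathbb{R})\times\mathfrak{aff}(\mathbb{R})$ with inner product $\langle\cdot,\cdot\rangle_{t,s}$: $H_{a_1,a_2}$ with $a_1,a_2\ge0$ if $s<1$, and with $a_1\ge a_2\ge0$ if $s=1$; (5) $\mathfrak{d}_{4,\frac12}$: $e_1\mapsto ce_2,\ e_2\mapsto-ce_1,\ e_3\mapsto-ce_4,\ e_4\mapsto ce_3$, with $c>0$; (6) $\mathfrak{d}_{4,2}$: $e_1\mapsto ce_4,\ e_2\mapsto ce_3,\ e_3\mapsto-ce_2,\ e_4\mapsto-ce_1$, with $c>0$; (7) $\mathfrak{d}'_{4,\frac{\delta}{2}}$: $e_1\mapsto ce_2,\ e_2\mapsto-ce_1,\ e_3\mapsto-ce_4,\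 e_4\mapsto ce_3$, with $c\in\mathbb{R}\setminus\{0\}$.
   Context: A metric Lie algebra $(\mathfrak{g},\langle\cdot,\cdot\rangle)$ is a finite-dimensional real Lie algebra with a (positive definite) inner product. For $x\in\mathfrak{g}$, $\nabla_x:\mathfrak{g}\to\mathfrak{g}$ is defined by the Koszul formula $2\langle\nabla_xy,z\rangle=\langle[x,y],z\rangle-\langle[y,z],x\rangle+\langle[z,x],y\rangle$. An endomorphism $H$ of $\mathfrak{g}$ that is skew-symmetric with respect to $\langle\cdot,\cdot\rangle$ is parallel if $\nabla_x(Hy)=H\nabla_xy$ for all $x,y\in\mathfrak{g}$. Two metric Lie algebras are equivalent if there is an isometric Lie algebra isomorphism between them. Two parallel skew-symmetric endomorphisms $H_1,H_2$ on the same metric Lie algebra $(\mathfrak{g},\langle\cdot,\cdot\rangle)$ are equivalent if there is an isometric Lie algebra automorphism $\phi:\mathfrak{g}\to\mathfrak{g}$ with $\phi H_1=H_2\phi$. The seven families (brackets of basis elements not listed and not determined by antisymmetry are zero; $\mathrm{diag}$ is the Gram matrix of the inner product in the given ordered basis). In (1)-(4) the ordered basis is $(e_1,f_1,e_2,f_2)$: (1) $\mathbb{R}\times\mathfrak{e}(2)$: $[e_1,e_2]=-f_2$, $[e_1,f_2]=e_2$; $\langle\cdot,\cdot\rangle_t=\mathrm{diag}(t,t,t,t)$, $t>0$. (2) $\mathbb{R}^2\times\mathfrak{aff}(\mathbb{R})$: $[e_2,f_2]=f_2$; $\langle\cdot,\cdot\rangle_t=\mathrm{diag}(t,t,t,t)$,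 $t>0$. (3) $\mathfrak{r}'_{4,\lambda,0}$, $\lambda>0$: $[e_1,f_1]=\lambda f_1$, $[e_1,f_2]=e_2$, $[e_1,e_2]=-f_2$; $\langle\cdot,\cdot\rangle_t=\mathrm{diag}(t,t,t,t)$, $t>0$. (4) $\mathfrak{aff}(\mathbb{R})\times\mathfrak{aff}(\mathbb{R})$: $[e_1,f_1]=f_1$, $[e_2,f_2]=f_2$; $\langle\cdot,\cdot\rangle_{t,s}=\mathrm{diag}(t,t,ts,ts)$, $t>0$, $0<s\le1$. In (5)-(7) the ordered basis is $(e_1,e_2,e_3,e_4)$ and the inner product is $\langle\cdot,\cdot\rangle_t=\mathrm{diag}(t,t,t,t)$, $t>0$: (5) $\mathfrak{d}_{4,\frac12}$: $[e_1,e_2]=e_3$, $[e_4,e_1]=\frac12e_1$, $[e_4,e_2]=\frac12e_2$, $[e_4,e_3]=e_3$. (6) $\mathfrak{d}_{4,2}$: $[e_1,e_2]=e_3$, $[e_4,e_1]=e_1$, $[e_4,e_2]=-\frac12e_2$, $[e_4,e_3]=\frac12e_3$. (7) $\mathfrak{d}'_{4,\frac{\delta}{2}}$, $\delta>0$: $[e_1,e_2]=e_3$, $[e_4,e_1]=\frac12e_1-\frac1\delta e_2$, $[e_4,e_2]=\frac1\delta e_1+\frac12e_2$, $[e_4,e_3]=e_3$. *)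

theory Defs
  imports "HOL-Analysis.Analysis"
begin

section \<open>Metric Lie algebras\<close>

text \<open>
  A structure on a finite-dimensional real vector space consists of a bracket and an inner product.
  The class \<open>euclidean_space\<close> is used only to obtain a finite-dimensional carrier: its built-in inner
  product plays no role in the definitions, the inner product is \<open>ip\<close>.
\<close>

record 'a metric_lie =
  br :: "'a \<Rightarrow> 'a \<Rightarrow> 'a"
  ip :: "'a \<Rightarrow> 'a \<Rightarrow> real"

definition metric_lie_algebra :: "'a::euclidean_space metric_lie \<Rightarrow> bool" where
  "metric_lie_algebra M \<longleftrightarrow>
     bilinear (br M) \<and>
     (\<forall>x. br M x x = 0) \<and>
     (\<forall>x y z. br M x (br M y z) + br M y (br M z x) + br M z (br M x y) = 0) \<and>
     bilinear (ip M) \<and>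
     (\<forall>x y. ip M x y = ip M y x) \<and>
     (\<forall>x. x \<noteq> 0 \<longrightarrow> ip M x x > 0)"

definition koszul :: "'a::euclidean_space metric_lie \<Rightarrow> 'a \<Rightarrow> 'a \<Rightarrow> 'a \<Rightarrow> real" where
  "koszul M x y z = ip M (br M x y) z - ip M (br M y z) x + ip M (br M z x) y"

text \<open>The description is proper for every metric Lie algebra; see \<open>nabla_eqI\<close> and \<open>nabla_koszul\<close>.\<close>

definition nabla :: "'a::euclidean_space metric_lie \<Rightarrow> 'a \<Rightarrow> 'a \<Rightarrow> 'a" where
  "nabla M x y = (THE w. \<forall>z. 2 * ip M w z = koszul M x y z)"

definition skew_symmetric :: "'a::euclidean_space metric_lie \<Rightarrow> ('a \<Rightarrow> 'a) \<Rightarrow> bool" where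
  "skew_symmetric M H \<longleftrightarrow> linear H \<and> (\<forall>x y. ip M (H x) y = - ip M x (H y))"

definition parallel :: "'a::euclidean_space metric_lie \<Rightarrow> ('a \<Rightarrow> 'a) \<Rightarrow> bool" where
  "parallel M H \<longleftrightarrow> (\<forall>x y. nabla M x (H y) = H (nabla M x y))"

definition isometric_iso ::
  "'a::euclidean_space metric_lie \<Rightarrow> 'b::euclidean_space metric_lie \<Rightarrow> ('a \<Rightarrow> 'b) \<Rightarrow> bool" where
  "isometric_iso M N \<phi> \<longleftrightarrow>
     linear \<phi> \<and> bij \<phi> \<and>
     (\<forall>x y. \<phi> (br M x y) = br N (\<phi> x) (\<phi> y)) \<and>
     (\<forall>x y. ip N (\<phi> x) (\<phi> y) = ip M x y)"

definition metric_lie_equiv ::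
  "'a::euclidean_space metric_lie \<Rightarrow> 'b::euclidean_space metric_lie \<Rightarrow> bool" where
  "metric_lie_equiv M N \<longleftrightarrow> (\<exists>\<phi>. isometric_iso M N \<phi>)"

definition endo_equiv :: "'a::euclidean_space metric_lie \<Rightarrow> ('a \<Rightarrow> 'a) \<Rightarrow> ('a \<Rightarrow> 'a) \<Rightarrow> bool" where
  "endo_equiv M H\<^sub>1 H\<^sub>2 \<longleftrightarrow> (\<exists>\<phi>. isometric_iso M M \<phi> \<and> \<phi> \<circ> H\<^sub>1 = H\<^sub>2 \<circ> \<phi>)"


section \<open>Structures on \<open>\<real>\<^sup>4\<close> given in a basis\<close>

abbreviation E :: "4 \<Rightarrow> real^4" where
  "E i \<equiv> axis i 1"

text \<open>
  An entry \<open>(i, j, v)\<close> of the table stands for \<open>[E i, E j] = v\<close>. The bracket is the bilinear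
  extension of the listed values and of \<open>[E j, E i] = -v\<close>, with all other brackets of basis
  elements equal to zero.
\<close>

definition bracket_of :: "(4 \<times> 4 \<times> (real^4)) list \<Rightarrow> real^4 \<Rightarrow> real^4 \<Rightarrow> real^4" where
  "bracket_of tbl x y = (\<Sum>(i, j, v)\<leftarrow>tbl. (x$i * y$j - x$j * y$i) *\<^sub>R v)"

definition diag_ip :: "real \<Rightarrow> real \<Rightarrow> real \<Rightarrow> real \<Rightarrow> real^4 \<Rightarrow> real^4 \<Rightarrow> real" where
  "diag_ip d\<^sub>1 d\<^sub>2 d\<^sub>3 d\<^sub>4 x y = d\<^sub>1 * x$1 * y$1 + d\<^sub>2 * x$2 * y$2 + d\<^sub>3 * x$3 * y$3 + d\<^sub>4 * x$4 * y$4"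

text \<open>The linear map with \<open>E 1 \<mapsto> v\<^sub>1\<close>, \<dots>, \<open>E 4 \<mapsto> v\<^sub>4\<close>.\<close>

definition endo_of :: "real^4 \<Rightarrow> real^4 \<Rightarrow> real^4 \<Rightarrow> real^4 \<Rightarrow> real^4 \<Rightarrow> real^4" where
  "endo_of v\<^sub>1 v\<^sub>2 v\<^sub>3 v\<^sub>4 x = x$1 *\<^sub>R v\<^sub>1 + x$2 *\<^sub>R v\<^sub>2 + x$3 *\<^sub>R v\<^sub>3 + x$4 *\<^sub>R v\<^sub>4"


section \<open>The seven families\<close>

text \<open>One constructor per family; its arguments are the parameters of the metric Lie algebra.\<close>

datatype family =
    R_E2 real           \<comment> \<open>\<open>\<real> \<times> \<ee>(2)\<close>, argument \<open>t\<close>\<close>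
  | RR_Aff real         \<comment> \<open>\<open>\<real>\<^sup>2 \<times> \<aa>\<ff>\<ff>(\<real>)\<close>, argument \<open>t\<close>\<close>
  | R4' real real       \<comment> \<open>\<open>\<rr>'\<^bsub>4,\<lambda>,0\<^esub>\<close>, arguments \<open>\<lambda>\<close>, \<open>t\<close>\<close>
  | Aff_Aff real real   \<comment> \<open>\<open>\<aa>\<ff>\<ff>(\<real>) \<times> \<aa>\<ff>\<ff>(\<real>)\<close>, arguments \<open>t\<close>, \<open>s\<close>\<close>
  | D4_half real        \<comment> \<open>\<open>\<dd>\<^bsub>4,1/2\<^esub>\<close>, argument \<open>t\<close>\<close>
  | D4_two real         \<comment> \<open>\<open>\<dd>\<^bsub>4,2\<^esub>\<close>, argument \<open>t\<close>\<close>
  | D4' real real       \<comment> \<open>\<open>\<dd>'\<^bsub>4,\<delta>/2\<^esub>\<close>, arguments \<open>\<delta>\<close>, \<open>t\<close>\<close>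

fun admissible :: "family \<Rightarrow> bool" where
  "admissible (R_E2 t) \<longleftrightarrow> t > 0"
| "admissible (RR_Aff t) \<longleftrightarrow> t > 0"
| "admissible (R4' l t) \<longleftrightarrow> l > 0 \<and> t > 0"
| "admissible (Aff_Aff t s) \<longleftrightarrow> t > 0 \<and> 0 < s \<and> s \<le> 1"
| "admissible (D4_half t) \<longleftrightarrow> t > 0"
| "admissible (D4_two t) \<longleftrightarrow> t > 0"
| "admissible (D4' d t) \<longleftrightarrow> d > 0 \<and> t > 0"

text \<open>
  In the first four families the ordered basis \<open>(e\<^sub>1, f\<^sub>1, e\<^sub>2, f\<^sub>2)\<close> is \<open>(E 1, E 2, E 3, E 4)\<close>;
  in the last three \<open>(e\<^sub>1, e\<^sub>2, e\<^sub>3, e\<^sub>4)\<close> is \<open>(E 1, E 2, E 3, E 4)\<close>.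
\<close>

fun family_bracket :: "family \<Rightarrow> real^4 \<Rightarrow> real^4 \<Rightarrow> real^4" where
  "family_bracket (R_E2 t) = bracket_of [(1, 3, - E 4), (1, 4, E 3)]"
| "family_bracket (RR_Aff t) = bracket_of [(3, 4, E 4)]"
| "family_bracket (R4' l t) = bracket_of [(1, 2, l *\<^sub>R E 2), (1, 4, E 3), (1, 3, - E 4)]"
| "family_bracket (Aff_Aff t s) = bracket_of [(1, 2, E 2), (3, 4, E 4)]"
| "family_bracket (D4_half t) =
     bracket_of [(1, 2, E 3), (4, 1, (1/2) *\<^sub>R E 1), (4, 2, (1/2) *\<^sub>R E 2), (4, 3, E 3)]"
| "family_bracket (D4_two t) =
     bracket_of [(1, 2, E 3), (4, 1, E 1), (4, 2, (-1/2) *\<^sub>R E 2), (4, 3, (1/2) *\<^sub>R E 3)]"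
| "family_bracket (D4' d t) =
     bracket_of [(1, 2, E 3), (4, 1, (1/2) *\<^sub>R E 1 - (1/d) *\<^sub>R E 2),
                 (4, 2, (1/d) *\<^sub>R E 1 + (1/2) *\<^sub>R E 2), (4, 3, E 3)]"

fun family_ip :: "family \<Rightarrow> real^4 \<Rightarrow> real^4 \<Rightarrow> real" where
  "family_ip (R_E2 t) = diag_ip t t t t"
| "family_ip (RR_Aff t) = diag_ip t t t t"
| "family_ip (R4' l t) = diag_ip t t t t"
| "family_ip (Aff_Aff t s) = diag_ip t t (t * s) (t * s)"
| "family_ip (D4_half t) = diag_ip t t t t"
| "family_ip (D4_two t) = diag_ip t t t t"
| "family_ip (D4' d t) = diag_ip t t t t"

definition family_algebra :: "family \<Rightarrow> (real^4) metric_lie" where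
  "family_algebra p = \<lparr> br = family_bracket p, ip = family_ip p \<rparr>"


section \<open>The listed endomorphisms\<close>

definition H_ab :: "real \<Rightarrow> real \<Rightarrow> real^4 \<Rightarrow> real^4" where
  "H_ab a\<^sub>1 a\<^sub>2 = endo_of (a\<^sub>1 *\<^sub>R E 2) (- a\<^sub>1 *\<^sub>R E 1) (a\<^sub>2 *\<^sub>R E 4) (- a\<^sub>2 *\<^sub>R E 3)"

definition K_12 :: "real \<Rightarrow> real^4 \<Rightarrow> real^4" where
  "K_12 c = endo_of (c *\<^sub>R E 2) (- c *\<^sub>R E 1) (- c *\<^sub>R E 4) (c *\<^sub>R E 3)"

definition K_14 :: "real \<Rightarrow> real^4 \<Rightarrow> real^4" where
  "K_14 c = endo_of (c *\<^sub>R E 4) (c *\<^sub>R E 3) (- c *\<^sub>R E 2) (- c *\<^sub>R E 1)"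

text \<open>For the first four families the list contains the zero endomorphism \<open>H_ab 0 0\<close>.\<close>

fun listed_endos :: "family \<Rightarrow> (real^4 \<Rightarrow> real^4) set" where
  "listed_endos (R_E2 t) = {H_ab a\<^sub>1 a\<^sub>2 | a\<^sub>1 a\<^sub>2. a\<^sub>1 \<ge> 0 \<and> a\<^sub>2 \<ge> 0}"
| "listed_endos (RR_Aff t) = {H_ab a\<^sub>1 a\<^sub>2 | a\<^sub>1 a\<^sub>2. a\<^sub>1 \<ge> 0 \<and> a\<^sub>2 \<ge> 0}"
| "listed_endos (R4' l t) = {H_ab a\<^sub>1 a\<^sub>2 | a\<^sub>1 a\<^sub>2. a\<^sub>1 \<ge> 0}"
| "listed_endos (Aff_Aff t s) =
     (if s < 1 then {H_ab a\<^sub>1 a\<^sub>2 | a\<^sub>1 a\<^sub>2. a\<^sub>1 \<ge> 0 \<and> a\<^sub>2 \<ge> 0}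
      else {H_ab a\<^sub>1 a\<^sub>2 | a\<^sub>1 a\<^sub>2. a\<^sub>1 \<ge> a\<^sub>2 \<and> a\<^sub>2 \<ge> 0})"
| "listed_endos (D4_half t) = {K_12 c | c. c > 0}"
| "listed_endos (D4_two t) = {K_14 c | c. c > 0}"
| "listed_endos (D4' d t) = {K_12 c | c. c \<noteq> 0}"


section \<open>Well-definedness\<close>

lemma metric_lie_algebra_ip_unique:
  assumes M: "metric_lie_algebra M" and eq: "\<And>z. ip M v z = ip M w z"
  shows "v = w"
proof (rule ccontr)
  assume "v \<noteq> w"
  then have "ip M (v - w) (v - w) > 0"
    using M by (auto simp: metric_lie_algebra_def)
  moreover have "ip M (v - w) (v - w) = ip M v (v - w) - ip M w (v - w)"
    using M by (simp add: metric_lie_algebra_def bilinear_lsub)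
  ultimately show False using eq by simp
qed

lemma metric_lie_algebra_riesz:
  fixes M :: "'a::euclidean_space metric_lie"
  assumes M: "metric_lie_algebra M" and f: "linear f"
  shows "\<exists>w. \<forall>z. ip M w z = f z"
proof -
  have bil: "bilinear (ip M)" using M by (simp add: metric_lie_algebra_def)
  define A where "A w = (\<Sum>b\<in>Basis. ip M w b *\<^sub>R b)" for w
  have lin_r: "linear (ip M w)" for w using bil by (simp add: bilinear_def)
  have A_ip: "A w \<bullet> z = ip M w z" for w z
  proof -
    have "ip M w z = ip M w (\<Sum>b\<in>Basis. (z \<bullet> b) *\<^sub>R b)" by (simp add: euclidean_representation)
    also have "\<dots> = (\<Sum>b\<in>Basis. (z \<bullet> b) * ip M w b)"
      by (simp add: linear_sum[OF lin_r] linear_scale[OF lin_r])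
    finally show ?thesis by (simp add: A_def inner_sum_left inner_commute[of z] mult.commute)
  qed
  have "linear A"
    by (rule linearI) (simp_all add: A_def bilinear_ladd[OF bil] bilinear_lmul[OF bil]
        scaleR_add_left sum.distrib scaleR_sum_right)
  moreover have "inj A"
    by (rule injI) (metis A_ip metric_lie_algebra_ip_unique[OF M])
  ultimately have "surj A" by (simp add: linear_injective_imp_surjective)
  then obtain w where w: "A w = (\<Sum>b\<in>Basis. f b *\<^sub>R b)" by (metis surjD)
  have "ip M w z = f z" for z
  proof -
    have "f z = f (\<Sum>b\<in>Basis. (z \<bullet> b) *\<^sub>R b)" by (simp add: euclidean_representation)
    also have "\<dots> = (\<Sum>b\<in>Basis. (z \<bullet> b) * f b)"
      by (simp add: linear_sum[OF f] linear_scale[OF f])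
    also have "\<dots> = A w \<bullet> z" by (simp add: w inner_sum_left inner_commute[of z] mult.commute)
    finally show ?thesis by (simp add: A_ip)
  qed
  then show ?thesis by blast
qed

lemma nabla_eqI:
  assumes M: "metric_lie_algebra M" and w: "\<And>z. 2 * ip M w z = koszul M x y z"
  shows "nabla M x y = w"
  unfolding nabla_def
proof (rule the_equality)
  show "\<forall>z. 2 * ip M w z = koszul M x y z" using w by blast
  show "v = w" if v: "\<forall>z. 2 * ip M v z = koszul M x y z" for v
  proof (rule metric_lie_algebra_ip_unique[OF M])
    fix z
    show "ip M v z = ip M w z" using v[rule_format, of z] w[of z] by linarith
  qed
qed

lemma nabla_koszul:
  assumes M: "metric_lie_algebra M"
  shows "2 * ip M (nabla M x y) z = koszul M x y z"
proof -
  have b: "bilinear (br M)" "bilinear (ip M)" using M by (simp_all add: metric_lie_algebra_def)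
  have "linear (\<lambda>z. koszul M x y z / 2)"
    by (rule linearI) (simp_all add: koszul_def bilinear_ladd[OF b(1)] bilinear_radd[OF b(1)]
        bilinear_ladd[OF b(2)] bilinear_radd[OF b(2)] bilinear_lmul[OF b(1)] bilinear_rmul[OF b(1)]
        bilinear_lmul[OF b(2)] bilinear_rmul[OF b(2)] field_simps)
  from metric_lie_algebra_riesz[OF M this] obtain w where w0: "\<And>z. ip M w z = koszul M x y z / 2"
    by blast
  have w: "2 * ip M w z = koszul M x y z" for z using w0[of z] by simp
  show ?thesis by (simp only: nabla_eqI[OF M w] w)
qed

lemma parallel_iff_koszul:
  assumes M: "metric_lie_algebra M" and H: "skew_symmetric M H"
  shows "parallel M H \<longleftrightarrow> (\<forall>x y z. koszul M x (H y) z = - koszul M x y (H z))"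
proof -
  have "nabla M x (H y) = H (nabla M x y) \<longleftrightarrow> (\<forall>z. koszul M x (H y) z = - koszul M x y (H z))"
    for x y
  proof -
    have H_ip: "2 * ip M (H (nabla M x y)) z = - koszul M x y (H z)" for z
      using H nabla_koszul[OF M, of x y "H z"] by (simp add: skew_symmetric_def)
    show ?thesis
    proof
      assume "nabla M x (H y) = H (nabla M x y)"
      then show "\<forall>z. koszul M x (H y) z = - koszul M x y (H z)"
        using H_ip nabla_koszul[OF M, of x "H y"] by metis
    next
      assume "\<forall>z. koszul M x (H y) z = - koszul M x y (H z)"
      then show "nabla M x (H y) = H (nabla M x y)"
        using H_ip by (intro nabla_eqI[OF M]) simp
    qed
  qed
  then show ?thesis by (simp add: parallel_def)
qed

lemma bilinear_bracket_of: "bilinear (bracket_of tbl)"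
proof -
  have "linear (\<lambda>y. bracket_of tbl x y)" "linear (\<lambda>y. bracket_of tbl y x)" for x
    by (rule linearI; induction tbl; auto simp: bracket_of_def algebra_simps)+
  then show ?thesis by (simp add: bilinear_def)
qed

lemma bracket_of_self: "bracket_of tbl x x = 0"
  by (induction tbl) (auto simp: bracket_of_def)

lemma bilinear_diag_ip: "bilinear (diag_ip a b c d)"
  unfolding bilinear_def diag_ip_def by (auto intro!: linearI simp: algebra_simps)

lemma diag_ip_pos:
  assumes "a > 0" "b > 0" "c > 0" "d > 0" "x \<noteq> 0"
  shows "diag_ip a b c d x x > 0"
proof -
  have eq: "diag_ip a b c d x x = a * (x$1)\<^sup>2 + b * (x$2)\<^sup>2 + c * (x$3)\<^sup>2 + d * (x$4)\<^sup>2"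
    by (simp add: diag_ip_def power2_eq_square algebra_simps)
  have nn: "a * (x$1)\<^sup>2 \<ge> 0" "b * (x$2)\<^sup>2 \<ge> 0" "c * (x$3)\<^sup>2 \<ge> 0" "d * (x$4)\<^sup>2 \<ge> 0"
    using assms by simp_all
  from \<open>x \<noteq> 0\<close> consider "x$1 \<noteq> 0" | "x$2 \<noteq> 0" | "x$3 \<noteq> 0" | "x$4 \<noteq> 0"
    by (auto simp: vec_eq_iff forall_4)
  then show ?thesis
  proof cases
    case 1
    then have "a * (x$1)\<^sup>2 > 0" using assms by simp
    then show ?thesis using eq nn by linarith
  next
    case 2
    then have "b * (x$2)\<^sup>2 > 0" using assms by simp
    then show ?thesis using eq nn by linarith
  next
    case 3
    then have "c * (x$3)\<^sup>2 > 0" using assms by simp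
    then show ?thesis using eq nn by linarith
  next
    case 4
    then have "d * (x$4)\<^sup>2 > 0" using assms by simp
    then show ?thesis using eq nn by linarith
  qed
qed

lemma metric_lie_algebra_family:
  assumes p: "admissible p"
  shows "metric_lie_algebra (family_algebra p)"
proof -
  have "bilinear (family_bracket p)" "family_bracket p x x = 0" for x
    by (cases p; simp add: bilinear_bracket_of bracket_of_self)+
  moreover have "bilinear (family_ip p)" "family_ip p x y = family_ip p y x" for x y
    by (cases p; simp add: bilinear_diag_ip; simp add: diag_ip_def)+
  moreover have "family_ip p x x > 0" if "x \<noteq> 0" for x
    using p that by (cases p) (auto intro!: diag_ip_pos)
  moreover have "family_bracket p x (family_bracket p y z) + family_bracket p y (family_bracket p z x)
      + family_bracket p z (family_bracket p x y) = 0" for x y z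
    by (cases p; simp add: bracket_of_def vec_eq_iff forall_4 axis_def;
        simp add: algebra_simps add_divide_distrib diff_divide_distrib)
  ultimately show ?thesis by (simp add: metric_lie_algebra_def family_algebra_def)
qed

lemma listed_endos_skew_parallel:
  assumes p: "admissible p" and H: "H \<in> listed_endos p"
  shows "skew_symmetric (family_algebra p) H" and "parallel (family_algebra p) H"
proof -
  have lin: "linear (endo_of v w x y)" for v w x y
    by (rule linearI) (simp_all add: endo_of_def algebra_simps)
  show skew: "skew_symmetric (family_algebra p) H"
    using H by (cases p) (auto simp: skew_symmetric_def H_ab_def K_12_def K_14_def lin
      family_algebra_def diag_ip_def endo_of_def axis_def algebra_simps split: if_splits)
  have "koszul (family_algebra p) x (H y) z = - koszul (family_algebra p) x y (H z)" for x y z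
    using H by (cases p) (auto simp: koszul_def H_ab_def K_12_def K_14_def
      family_algebra_def diag_ip_def endo_of_def bracket_of_def axis_def algebra_simps split: if_splits)
  then show "parallel (family_algebra p) H"
    using parallel_iff_koszul[OF metric_lie_algebra_family[OF p] skew] by blast
qed

end

theory Submission
  imports Defs
begin

text \<open>
  Non-equivalence. An isometric isomorphism carries \<open>ad x\<close> to a conjugate map, so it preserves the
  linear form \<open>\<tau>(x) = tr (ad x)\<close> and the quadratic form \<open>B(x) = tr ((ad x)\<^sup>2)\<close> (the Killing form), and
  therefore the set of all \<open>c\<close> with \<open>B = c \<tau>\<^sup>2\<close>, the least constants bounding \<open>\<tau>\<^sup>2\<close> and \<open>\<bar>B\<bar>\<close> by the
  metric, and the property of being metabelian. The first four families are metabelian and the last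
  three are not. The ratio \<open>c\<close> does not exist for \<open>\<real> \<times> \<ee>(2)\<close> and \<open>\<aa>\<ff>\<ff>(\<real>) \<times> \<aa>\<ff>\<ff>(\<real>)\<close>, which are told apart
  by \<open>\<tau> = 0\<close>; in the other families it exists, is unique, and together with metabelianity it determines
  the family and \<open>\<lambda>\<close> or \<open>\<delta>\<close>. The sharp constants then determine \<open>t\<close> and \<open>s\<close>.

  Normal forms. By the Koszul formula, being parallel is a system of linear equations in the matrix
  entries of \<open>H\<close>, and a few basis triples already force \<open>H\<close> to be one of \<open>H_ab\<close>, \<open>K_12\<close>, \<open>K_14\<close> with
  arbitrary real parameters (\<open>parallel_form\<close>). Automorphisms that change signs of basis vectors, and
  the exchange of the two factors of \<open>\<aa>\<ff>\<ff>(\<real>) \<times> \<aa>\<ff>\<ff>(\<real>)\<close> when \<open>s = 1\<close>, bring the parameters into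
  the listed ranges (\<open>normal_form_exists\<close>).

  Uniqueness. Equivalent endomorphisms have the same \<open>tr (H\<^sup>2)\<close>, which settles \<open>K_12\<close> and \<open>K_14\<close> up to
  sign. For \<open>H_ab a b\<close> it gives \<open>a\<^sup>2 + b\<^sup>2\<close>, and the eigenvalue of \<open>H\<^sup>2\<close> at a vector whose image under
  the automorphism can be located determines \<open>a\<^sup>2\<close> and \<open>b\<^sup>2\<close> separately. For \<open>\<rr>'\<^bsub>4,\<lambda>,0\<^esub>\<close> and
  \<open>\<dd>'\<^bsub>4,\<delta>/2\<^esub>\<close> an automorphism fixes the vector \<open>v\<close> dual to \<open>\<tau>\<close>, so \<open>tr (ad v \<circ> H)\<close> is an invariant,
  and it is odd in the parameter whose sign has to be recovered.
\<close>

section \<open>Invariants of metric Lie algebras\<close>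

text \<open>The linear form \<open>x \<mapsto> tr (ad x)\<close>.\<close>

definition tau :: "(real^'n) metric_lie \<Rightarrow> real^'n \<Rightarrow> real" where
  "tau M x = trace (matrix (br M x))"

text \<open>The quadratic form of the Killing form, \<open>x \<mapsto> tr ((ad x)\<^sup>2)\<close>.\<close>

definition kil :: "(real^'n) metric_lie \<Rightarrow> real^'n \<Rightarrow> real" where
  "kil M x = trace (matrix (br M x \<circ> br M x))"

text \<open>The derived algebra is abelian. It suffices to test brackets, which span it.\<close>

definition metabelian :: "'a::euclidean_space metric_lie \<Rightarrow> bool" where
  "metabelian M \<longleftrightarrow> (\<forall>x y z w. br M (br M x y) (br M z w) = 0)"

text \<open>All \<open>c\<close> with \<open>kil = c tau\<^sup>2\<close>: empty, a single number, or everything if both forms vanish.\<close>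

definition kil_ratios :: "(real^'n) metric_lie \<Rightarrow> real set" where
  "kil_ratios M = {c. \<forall>x. kil M x = c * (tau M x)\<^sup>2}"

text \<open>
  For \<open>f\<close> homogeneous of degree two, the maximum of \<open>f\<close> on the unit sphere is \<open>C\<close>. It is stated
  homogeneously, so that vectors need not be normalised; the vector that attains the bound must have
  positive length, as otherwise \<open>0\<close> would attain every bound.
\<close>

definition sharp_bound :: "'a::euclidean_space metric_lie \<Rightarrow> ('a \<Rightarrow> real) \<Rightarrow> real \<Rightarrow> bool" where
  "sharp_bound M f C \<longleftrightarrow> (\<forall>x. f x \<le> C * ip M x x) \<and> (\<exists>x. ip M x x > 0 \<and> f x = C * ip M x x)"

lemma trace_matrix_conj:
  fixes \<phi> f g :: "real^'n \<Rightarrow> real^'n"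
  assumes "linear f" "linear g" "linear \<phi>" "bij \<phi>" and conj: "\<phi> \<circ> f = g \<circ> \<phi>"
  shows "trace (matrix f) = trace (matrix g)"
proof -
  let ?P = "matrix \<phi>"
  have "invertible ?P"
    using assms by (simp add: invertible_left_inverse matrix_left_invertible_injective
        matrix_works bij_is_inj)
  then obtain Q where Q: "?P ** Q = mat 1" "Q ** ?P = mat 1"
    by (auto simp: invertible_def)
  have "?P ** matrix f = matrix g ** ?P"
    using conj assms by (metis matrix_compose)
  then have "matrix g = (?P ** matrix f) ** Q"
    by (metis Q(1) matrix_mul_assoc matrix_mul_rid)
  then have "trace (matrix g) = trace (Q ** (?P ** matrix f))"
    by (metis trace_mul_sym)
  then show ?thesis
    by (simp add: matrix_mul_assoc Q)
qed

lemma linear_br: "metric_lie_algebra M \<Longrightarrow> linear (br M x)"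
  by (simp add: metric_lie_algebra_def bilinear_def)

lemma
  fixes M N :: "(real^'n) metric_lie"
  assumes "metric_lie_algebra M" "metric_lie_algebra N" "isometric_iso M N \<phi>"
  shows tau_iso: "tau N (\<phi> x) = tau M x" and kil_iso: "kil N (\<phi> x) = kil M x"
proof -
  have iso: "linear \<phi>" "bij \<phi>" "\<phi> \<circ> br M x = br N (\<phi> x) \<circ> \<phi>"
    using assms(3) by (auto simp: isometric_iso_def fun_eq_iff)
  show "tau N (\<phi> x) = tau M x"
    unfolding tau_def using trace_matrix_conj[OF _ _ iso] assms linear_br by metis
  have "\<phi> \<circ> (br M x \<circ> br M x) = (br N (\<phi> x) \<circ> br N (\<phi> x)) \<circ> \<phi>"
    using iso(3) by (metis comp_assoc)
  then show "kil N (\<phi> x) = kil M x"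
    unfolding kil_def using trace_matrix_conj[OF _ _ iso(1,2)] assms linear_br linear_compose by metis
qed

lemma metabelian_iso:
  assumes "isometric_iso M N \<phi>"
  shows "metabelian N \<longleftrightarrow> metabelian M"
proof -
  have iso: "linear \<phi>" "inj \<phi>" "surj \<phi>" "\<And>x y. \<phi> (br M x y) = br N (\<phi> x) (\<phi> y)"
    using assms by (auto simp: isometric_iso_def bij_def)
  have "br M (br M x y) (br M z w) = 0
      \<longleftrightarrow> br N (br N (\<phi> x) (\<phi> y)) (br N (\<phi> z) (\<phi> w)) = 0" for x y z w
    using iso(1,2) by (simp add: iso(4)[symmetric] linear_injective_0 linear_0) (metis linear_injective_0 linear_0)
  then show ?thesis
    unfolding metabelian_def using iso(3) by (metis surjD)
qed

lemma kil_ratios_iso: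
  fixes M N :: "(real^'n) metric_lie"
  assumes "metric_lie_algebra M" "metric_lie_algebra N" "isometric_iso M N \<phi>"
  shows "kil_ratios N = kil_ratios M"
proof -
  have "surj \<phi>" using assms(3) by (simp add: isometric_iso_def bij_def)
  then show ?thesis
    unfolding kil_ratios_def using tau_iso[OF assms] kil_iso[OF assms] by (metis surjD)
qed

lemma sharp_bound_unique:
  assumes "sharp_bound M f C" "sharp_bound M f D"
  shows "C = D"
proof -
  have "C \<le> D" if "sharp_bound M f C" "sharp_bound M f D" for C D
    using that unfolding sharp_bound_def by (metis mult_le_cancel_right_pos)
  then show ?thesis using assms by (meson antisym)
qed

lemma sharp_bound_iso:
  assumes "isometric_iso M N \<phi>" "\<And>x. g (\<phi> x) = f x" "sharp_bound M f C"
  shows "sharp_bound N g C"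
proof -
  have "surj \<phi>" "\<And>x. ip N (\<phi> x) (\<phi> x) = ip M x x"
    using assms(1) by (auto simp: isometric_iso_def bij_def)
  then show ?thesis
    using assms(2,3) unfolding sharp_bound_def by (metis surjD)
qed


section \<open>The invariants of the seven families\<close>

lemma br_family [simp]: "br (family_algebra p) = family_bracket p"
  and ip_family [simp]: "ip (family_algebra p) = family_ip p"
  by (simp_all add: family_algebra_def)

text \<open>The values of the invariants on the families: of \<open>kil_ratios\<close>, of the sharp bound for \<open>tau\<^sup>2\<close>, and of
  the pair \<open>(tau x, kil x)\<close>.\<close>

fun ratios_of :: "family \<Rightarrow> real set" where
  "ratios_of (R_E2 t) = {}"
| "ratios_of (RR_Aff t) = {1}"
| "ratios_of (R4' l t) = {1 - 2 / l\<^sup>2}"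
| "ratios_of (Aff_Aff t s) = {}"
| "ratios_of (D4_half t) = {3/8}"
| "ratios_of (D4_two t) = {3/2}"
| "ratios_of (D4' d t) = {3/8 - 1 / (2 * d\<^sup>2)}"

fun tau_bound :: "family \<Rightarrow> real" where
  "tau_bound (R_E2 t) = 0"
| "tau_bound (RR_Aff t) = 1 / t"
| "tau_bound (R4' l t) = l\<^sup>2 / t"
| "tau_bound (Aff_Aff t s) = 1 / t + 1 / (t * s)"
| "tau_bound (D4_half t) = 4 / t"
| "tau_bound (D4_two t) = 1 / t"
| "tau_bound (D4' d t) = 4 / t"

fun tau_kil_values :: "family \<Rightarrow> real^4 \<Rightarrow> real \<times> real" where
  "tau_kil_values (R_E2 t) x = (0, - 2 * (x$1)\<^sup>2)"
| "tau_kil_values (RR_Aff t) x = (x$3, (x$3)\<^sup>2)"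
| "tau_kil_values (R4' l t) x = (l * x$1, (l\<^sup>2 - 2) * (x$1)\<^sup>2)"
| "tau_kil_values (Aff_Aff t s) x = (x$1 + x$3, (x$1)\<^sup>2 + (x$3)\<^sup>2)"
| "tau_kil_values (D4_half t) x = (2 * x$4, 3/2 * (x$4)\<^sup>2)"
| "tau_kil_values (D4_two t) x = (x$4, 3/2 * (x$4)\<^sup>2)"
| "tau_kil_values (D4' d t) x = (2 * x$4, (3/2 - 2 / d\<^sup>2) * (x$4)\<^sup>2)"

lemma trace_matrix_4:
  fixes f :: "real^4 \<Rightarrow> real^4"
  shows "trace (matrix f) = f (E 1) $ 1 + f (E 2) $ 2 + f (E 3) $ 3 + f (E 4) $ 4"
  by (simp add: trace_def matrix_def sum_4)

lemma tau_kil_family: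
  "tau (family_algebra p) x = fst (tau_kil_values p x)"
  "kil (family_algebra p) x = snd (tau_kil_values p x)"
  by (cases p; simp add: tau_def kil_def trace_matrix_4 bracket_of_def
      axis_def power2_eq_square; simp add: field_simps)+

lemma metabelian_family:
  "metabelian (family_algebra p) \<longleftrightarrow>
    (case p of D4_half t \<Rightarrow> False | D4_two t \<Rightarrow> False | D4' d t \<Rightarrow> False | _ \<Rightarrow> True)"
proof -
  have not_metabelian: "\<not> metabelian M" if "br M (br M (E 4) (E 1)) (br M (E 4) (E 2)) $ 3 \<noteq> 0"
    for M :: "(real^4) metric_lie"
    using that unfolding metabelian_def by (metis zero_index)
  show ?thesis
  proof (cases p)
    case (D4' d t)
    have "1 / 4 + 1 / (d * d) > 0" by (rule add_pos_nonneg) auto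
    then show ?thesis
      using not_metabelian[of "family_algebra p"] by (simp add: D4' bracket_of_def axis_def)
  qed (use not_metabelian[of "family_algebra p"] in
      \<open>simp add: metabelian_def bracket_of_def axis_def vec_eq_iff forall_4\<close>)+
qed

lemma kil_ratios_family:
  assumes "admissible p"
  shows "kil_ratios (family_algebra p) = ratios_of p"
proof -
  have single: "{c::real. \<forall>x::real^4. A * (x$i)\<^sup>2 = c * (B * x$i)\<^sup>2} = {r}"
    if "A = r * B\<^sup>2" "B \<noteq> 0" for A B r i
  proof -
    have "c = r" if "\<And>x::real^4. A * (x$i)\<^sup>2 = c * (B * x$i)\<^sup>2" for c
      using that[of "E i"] \<open>A = r * B\<^sup>2\<close> \<open>B \<noteq> 0\<close> by simp
    then show ?thesis using that by (auto simp: power_mult_distrib)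
  qed
  show ?thesis
  proof (cases p)
    case (R_E2 t)
    show ?thesis by (auto simp: R_E2 kil_ratios_def tau_kil_family intro!: exI[of _ "E 1"])
  next
    case (RR_Aff t)
    show ?thesis using single[of 1 1 1 3] by (simp add: RR_Aff kil_ratios_def tau_kil_family)
  next
    case (R4' l t)
    then have "l\<^sup>2 - 2 = (1 - 2 / l\<^sup>2) * l\<^sup>2" "l \<noteq> 0"
      using assms by (auto simp: field_simps)
    from single[OF this, of 1] show ?thesis by (simp add: R4' kil_ratios_def tau_kil_family)
  next
    case (Aff_Aff t s)
    \<comment> \<open>\<open>tau\<close> vanishes at \<open>E 1 - E 3\<close> and \<open>kil\<close> does not.\<close>
    have False if c: "\<And>x::real^4. (x$1)\<^sup>2 + (x$3)\<^sup>2 = c * (x$1 + x$3)\<^sup>2" for c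
      using c[of "E 1 - E 3"] by (simp add: axis_def)
    then show ?thesis by (auto simp: Aff_Aff kil_ratios_def tau_kil_family)
  next
    case (D4_half t)
    show ?thesis using single[of "3/2" "3/8" 2 4] by (simp add: D4_half kil_ratios_def tau_kil_family)
  next
    case (D4_two t)
    show ?thesis using single[of "3/2" "3/2" 1 4] by (simp add: D4_two kil_ratios_def tau_kil_family)
  next
    case (D4' d t)
    have "3/2 - 2 / d\<^sup>2 = (3/8 - 1 / (2 * d\<^sup>2)) * 2\<^sup>2" by (simp add: field_simps)
    from single[OF this, of 4] show ?thesis by (simp add: D4' kil_ratios_def tau_kil_family)
  qed
qed

lemma sharp_bound_coordinate:
  fixes i :: 4
  assumes "t > 0" "c \<ge> 0" "ip M = diag_ip t t t t"
  shows "sharp_bound M (\<lambda>x. c * (x$i)\<^sup>2) (c / t)"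
  unfolding sharp_bound_def
proof (intro conjI allI exI)
  show "c * (x$i)\<^sup>2 \<le> c / t * ip M x x" for x
  proof -
    have "t * (x$i)\<^sup>2 \<le> diag_ip t t t t x x"
      using \<open>t > 0\<close> exhaust_4[of i] by (auto simp: diag_ip_def power2_eq_square mult.assoc)
    then have "c / t * (t * (x$i)\<^sup>2) \<le> c / t * ip M x x"
      using assms by (intro mult_left_mono) auto
    then show ?thesis using \<open>t > 0\<close> by simp
  qed
  show "ip M (E i) (E i) > 0" "c * (E i $ i)\<^sup>2 = c / t * ip M (E i) (E i)"
    using assms exhaust_4[of i] by (auto simp: diag_ip_def axis_def)
qed

lemma sharp_bound_tau:
  assumes "admissible p"
  shows "sharp_bound (family_algebra p) (\<lambda>x. (tau (family_algebra p) x)\<^sup>2) (tau_bound p)"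
proof (cases p)
  case (Aff_Aff t s)
  have pos: "t > 0" "s > 0" using assms by (auto simp: Aff_Aff)
  have "(x + z)\<^sup>2 \<le> (1 / t + 1 / (t * s)) * (t * x * x + t * y * y + t * s * z * z + t * s * w * w)" for x y z w :: real
  proof -
    \<comment> \<open>Cauchy-Schwarz with its defect written as a sum of squares; equality holds at \<open>(s, 0, 1, 0)\<close>.\<close>
    have "(1 / t + 1 / (t * s)) * (t * x * x + t * y * y + t * s * z * z + t * s * w * w)
        = (x + z)\<^sup>2 + (x - s * z)\<^sup>2 / s + (1 + 1/s) * y\<^sup>2 + (1 + s) * w\<^sup>2"
      using pos by (simp add: field_simps power2_eq_square)
    also have "\<dots> \<ge> (x + z)\<^sup>2" using pos by simp
    finally show ?thesis .
  qed
  moreover have "ip (family_algebra p) (s *\<^sub>R E 1 + E 3) (s *\<^sub>R E 1 + E 3) = t * s * s + t * s"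
    by (simp add: Aff_Aff diag_ip_def axis_def)
  moreover have "(s + 1)\<^sup>2 = (1 / t + 1 / (t * s)) * (t * s * s + t * s)"
    using pos by (simp add: field_simps power2_eq_square)
  moreover have "t * s * s + t * s > 0" using pos by (intro add_pos_pos mult_pos_pos)
  ultimately show ?thesis
    unfolding sharp_bound_def Aff_Aff
    by (intro conjI exI[of _ "s *\<^sub>R E 1 + E 3"]) (simp_all add: tau_kil_family diag_ip_def axis_def)
next
  case (R_E2 t)
  show ?thesis using sharp_bound_coordinate[of t "0" "family_algebra p" 1] assms
    by (simp add: R_E2 tau_kil_family power_mult_distrib)
next
  case (RR_Aff t)
  show ?thesis using sharp_bound_coordinate[of t "1" "family_algebra p" 3] assms
    by (simp add: RR_Aff tau_kil_family power_mult_distrib)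
next
  case (R4' l t)
  show ?thesis using sharp_bound_coordinate[of t "l\<^sup>2" "family_algebra p" 1] assms
    by (simp add: R4' tau_kil_family power_mult_distrib)
next
  case (D4_half t)
  show ?thesis using sharp_bound_coordinate[of t "4" "family_algebra p" 4] assms
    by (simp add: D4_half tau_kil_family power_mult_distrib)
next
  case (D4_two t)
  show ?thesis using sharp_bound_coordinate[of t "1" "family_algebra p" 4] assms
    by (simp add: D4_two tau_kil_family power_mult_distrib)
next
  case (D4' d t)
  show ?thesis using sharp_bound_coordinate[of t "4" "family_algebra p" 4] assms
    by (simp add: D4' tau_kil_family power_mult_distrib)
qed

text \<open>The bound for \<open>\<bar>kil\<bar>\<close> is needed only in the two families where \<open>kil\<close> is not a multiple of \<open>tau\<^sup>2\<close>.\<close>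

lemma sharp_bound_kil_R_E2:
  assumes "t > 0"
  shows "sharp_bound (family_algebra (R_E2 t)) (\<lambda>x. \<bar>kil (family_algebra (R_E2 t)) x\<bar>) (2 / t)"
  using sharp_bound_coordinate[of t 2 "family_algebra (R_E2 t)" 1] assms
  by (simp add: tau_kil_family)

lemma sharp_bound_kil_Aff_Aff:
  assumes "t > 0" "s > 0" "s \<le> 1"
  shows "sharp_bound (family_algebra (Aff_Aff t s)) (\<lambda>x. \<bar>kil (family_algebra (Aff_Aff t s)) x\<bar>)
    (1 / (t * s))"
proof -
  have "x\<^sup>2 + z\<^sup>2 \<le> 1 / (t * s) * (t * x * x + t * y * y + t * s * z * z + t * s * w * w)" for x y z w :: real
  proof -
    have "1 / (t * s) * (t * x * x + t * y * y + t * s * z * z + t * s * w * w)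
        = x\<^sup>2 + z\<^sup>2 + (1/s - 1) * x\<^sup>2 + y\<^sup>2 / s + w\<^sup>2"
      using assms by (simp add: field_simps power2_eq_square)
    also have "\<dots> \<ge> x\<^sup>2 + z\<^sup>2" using assms by simp
    finally show ?thesis .
  qed
  then show ?thesis
    using assms by (auto simp: sharp_bound_def tau_kil_family diag_ip_def
      axis_def intro!: exI[of _ "E 3"])
qed

lemma families_non_equivalent:
  assumes "admissible p" "admissible q"
    and equiv: "metric_lie_equiv (family_algebra p) (family_algebra q)"
  shows "p = q"
proof -
  let ?M = "family_algebra p" and ?N = "family_algebra q"
  obtain \<phi> where \<phi>: "isometric_iso ?M ?N \<phi>" using equiv by (auto simp: metric_lie_equiv_def)
  note iso = metric_lie_algebra_family[OF assms(1)] metric_lie_algebra_family[OF assms(2)] \<phi>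
  have met: "metabelian ?N = metabelian ?M" by (rule metabelian_iso[OF \<phi>])
  have rat: "ratios_of q = ratios_of p"
    using kil_ratios_iso[OF iso] by (simp add: kil_ratios_family assms)
  have "sharp_bound ?N (\<lambda>x. (tau ?N x)\<^sup>2) (tau_bound p)"
    by (rule sharp_bound_iso[OF \<phi> _ sharp_bound_tau[OF assms(1)]]) (simp add: tau_iso[OF iso])
  then have tb: "tau_bound q = tau_bound p"
    using sharp_bound_tau[OF assms(2)] sharp_bound_unique by blast
  have kb: "C = D" if "sharp_bound ?M (\<lambda>x. \<bar>kil ?M x\<bar>) C" "sharp_bound ?N (\<lambda>x. \<bar>kil ?N x\<bar>) D" for C D
    by (rule sharp_bound_unique[OF sharp_bound_iso[OF \<phi> _ that(1)] that(2)])
      (simp add: kil_iso[OF iso])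
  show ?thesis
  proof (cases "ratios_of p = {}")
    case True
    then consider t where "p = R_E2 t" | t s where "p = Aff_Aff t s" by (cases p) auto
    then show ?thesis
    proof cases
      case 1
      have "tau_bound q = 0" using tb 1 by simp
      moreover have "1 / t' + 1 / (t' * s') > 0" if "t' > 0" "s' > 0" for t' s' :: real
        using that by (simp add: add_pos_pos)
      ultimately obtain t' where q: "q = R_E2 t'"
        using rat True assms(2) by (cases q) force+
      show ?thesis
        using kb sharp_bound_kil_R_E2 assms unfolding 1 q by fastforce
    next
      case 2
      have "1 / t + 1 / (t * s) > 0" using assms(1) 2 by (simp add: add_pos_pos)
      then have "tau_bound q \<noteq> 0" using tb 2 by simp
      then obtain t' s' where q: "q = Aff_Aff t' s'"
        using rat True by (cases q) auto
      have pos: "t > 0" "s > 0" "t' > 0" "s' > 0" using assms by (auto simp: 2 q)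
      have k: "1 / (t * s) = 1 / (t' * s')"
        using kb sharp_bound_kil_Aff_Aff assms unfolding 2 q by fastforce
      then have "t = t'" using tb by (simp add: 2 q)
      then show ?thesis using k pos by (simp add: 2 q)
    qed
  next
    case False
    have sq: "l\<^sup>2 = l'\<^sup>2 \<longleftrightarrow> l = l'" if "l > 0" "l' > 0" for l l' :: real
      using that by (simp add: power2_eq_iff_nonneg)
    have neq: "3/8 - 1 / (2 * d\<^sup>2) < 3/2" for d :: real
      by (rule less_le_trans[of _ "1/2"]) (simp_all add: diff_less_eq add_pos_nonneg)
    show ?thesis
      using rat met tb assms False neq
      by (cases p; cases q) (simp_all add: metabelian_family sq less_imp_neq less_imp_neq[symmetric])
  qed
qed


section \<open>Parallel skew-symmetric endomorphisms\<close>

lemma E_nth: "E i $ j = (if j = i then 1 else 0)"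
  by (simp add: axis_def)

lemma mult_eq_minus_mult_iff: "(a::real) * x = - (a * y) \<longleftrightarrow> a = 0 \<or> x = - y"
  using mult_cancel_left[of a x "- y"] by simp

lemma linear_eq_endo_of:
  assumes "linear H" "H (E 1) = v1" "H (E 2) = v2" "H (E 3) = v3" "H (E 4) = v4"
  shows "H = endo_of v1 v2 v3 v4"
proof
  fix x :: "real^4"
  have "x = x$1 *\<^sub>R E 1 + x$2 *\<^sub>R E 2 + x$3 *\<^sub>R E 3 + x$4 *\<^sub>R E 4"
    by (simp add: vec_eq_iff forall_4 E_nth)
  then have "H x = H (x$1 *\<^sub>R E 1 + x$2 *\<^sub>R E 2 + x$3 *\<^sub>R E 3 + x$4 *\<^sub>R E 4)"
    by (rule arg_cong)
  then show "H x = endo_of v1 v2 v3 v4 x"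
    using assms by (simp add: endo_of_def linear_add linear_scale)
qed

text \<open>
  In coordinates \<open>H (E i) $ j\<close> is the matrix entry in row \<open>j\<close> and column \<open>i\<close>. For a metric that is
  constant on the planes \<open>(E 1, E 2)\<close> and \<open>(E 3, E 4)\<close>, skewness leaves six free entries.
\<close>

lemma skew_coords:
  assumes "skew_symmetric M H" "ip M = diag_ip a a b b" "a > 0" "b > 0"
  shows "H (E 1) $ 1 = 0" "H (E 2) $ 2 = 0" "H (E 3) $ 3 = 0" "H (E 4) $ 4 = 0"
    "H (E 2) $ 1 = - H (E 1) $ 2" "H (E 4) $ 3 = - H (E 3) $ 4"
    "a * H (E 3) $ 1 = - b * H (E 1) $ 3" "a * H (E 4) $ 1 = - b * H (E 1) $ 4"
    "a * H (E 3) $ 2 = - b * H (E 2) $ 3" "a * H (E 4) $ 2 = - b * H (E 2) $ 4"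
proof -
  have s: "ip M (H (E i)) (E j) = - ip M (E i) (H (E j))" for i j
    using assms(1) by (simp add: skew_symmetric_def)
  show "H (E 1) $ 1 = 0" "H (E 2) $ 2 = 0" "H (E 3) $ 3 = 0" "H (E 4) $ 4 = 0"
    "H (E 2) $ 1 = - H (E 1) $ 2" "H (E 4) $ 3 = - H (E 3) $ 4"
    "a * H (E 3) $ 1 = - b * H (E 1) $ 3" "a * H (E 4) $ 1 = - b * H (E 1) $ 4"
    "a * H (E 3) $ 2 = - b * H (E 2) $ 3" "a * H (E 4) $ 2 = - b * H (E 2) $ 4"
    using s[of 1 1] s[of 2 2] s[of 3 3] s[of 4 4] s[of 2 1] s[of 4 3] s[of 3 1] s[of 4 1]
      s[of 3 2] s[of 4 2] assms(3,4)
    by (simp_all add: assms(2) diag_ip_def E_nth mult.commute mult_eq_minus_mult_iff)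
qed

lemma H_ab_of_block:
  assumes "skew_symmetric M H" "ip M = diag_ip a a b b" "a > 0" "b > 0"
    and "H (E 1) $ 3 = 0" "H (E 1) $ 4 = 0" "H (E 2) $ 3 = 0" "H (E 2) $ 4 = 0"
  shows "H = H_ab (H (E 1) $ 2) (H (E 3) $ 4)"
proof -
  note s = skew_coords[OF assms(1-4)]
  have "H (E 3) $ 1 = 0" "H (E 4) $ 1 = 0" "H (E 3) $ 2 = 0" "H (E 4) $ 2 = 0"
    using s assms(3-) by simp_all
  then have "H (E 1) = H (E 1) $ 2 *\<^sub>R E 2" "H (E 2) = - H (E 1) $ 2 *\<^sub>R E 1"
    "H (E 3) = H (E 3) $ 4 *\<^sub>R E 4" "H (E 4) = - H (E 3) $ 4 *\<^sub>R E 3"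
    using s assms(5-) by (simp_all add: vec_eq_iff forall_4 E_nth)
  moreover have "linear H" using assms(1) by (simp add: skew_symmetric_def)
  ultimately show ?thesis unfolding H_ab_def by (intro linear_eq_endo_of)
qed

lemma K_12_of_coords:
  assumes "skew_symmetric M H" "ip M = diag_ip a a b b" "a > 0" "b > 0"
    and "H (E 1) $ 3 = 0" "H (E 1) $ 4 = 0" "H (E 2) $ 3 = 0" "H (E 2) $ 4 = 0"
      "H (E 3) $ 4 = - H (E 1) $ 2"
  shows "H = K_12 (H (E 1) $ 2)"
proof -
  have "H_ab c (- c) = K_12 c" for c by (simp add: H_ab_def K_12_def)
  then show ?thesis using H_ab_of_block[OF assms(1-8)] unfolding assms(9) by (rule trans[rotated])
qed

lemma K_14_of_coords:
  assumes "skew_symmetric M H" "ip M = diag_ip a a a a" "a > 0"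
    and "H (E 1) $ 2 = 0" "H (E 1) $ 3 = 0" "H (E 2) $ 4 = 0" "H (E 3) $ 4 = 0"
      "H (E 2) $ 3 = H (E 1) $ 4"
  shows "H = K_14 (H (E 1) $ 4)"
proof -
  note s = skew_coords[OF assms(1-3,3)]
  then have "H (E 1) = H (E 1) $ 4 *\<^sub>R E 4" "H (E 2) = H (E 1) $ 4 *\<^sub>R E 3"
    "H (E 3) = - H (E 1) $ 4 *\<^sub>R E 2" "H (E 4) = - H (E 1) $ 4 *\<^sub>R E 1"
    using assms(3-) by (simp_all add: vec_eq_iff forall_4 E_nth mult_eq_minus_mult_iff)
  moreover have "linear H" using assms(1) by (simp add: skew_symmetric_def)
  ultimately show ?thesis unfolding K_14_def by (intro linear_eq_endo_of)
qed

text \<open>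
  In each family \<open>k i j l\<close> below is one scalar equation of the system that makes \<open>H\<close> commute with
  \<open>\<nabla>\<close> in the direction \<open>E i\<close>. In the first four families and in \<open>\<dd>'\<^bsub>4,\<delta>/2\<^esub>\<close> one
  direction suffices to make \<open>H\<close> preserve the planes \<open>(E 1, E 2)\<close> and \<open>(E 3, E 4)\<close>; in the latter a
  further equation links the two rotations. For \<open>\<dd>\<^bsub>4,1/2\<^esub>\<close> and \<open>\<dd>\<^bsub>4,2\<^esub>\<close> the five chosen triples give
  a system of rank five in the six entries.
\<close>

lemma parallel_form:
  assumes p: "admissible p"
    and skew: "skew_symmetric (family_algebra p) H" and par: "parallel (family_algebra p) H"
  shows "case p of D4_half t \<Rightarrow> (\<exists>c. H = K_12 c) | D4_two t \<Rightarrow> (\<exists>c. H = K_14 c)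
    | D4' d t \<Rightarrow> (\<exists>c. H = K_12 c) | _ \<Rightarrow> (\<exists>a b. H = H_ab a b)"
proof -
  let ?M = "family_algebra p"
  have k: "koszul ?M (E i) (H (E j)) (E l) = - koszul ?M (E i) (E j) (H (E l))" for i j l
    using parallel_iff_koszul[OF metric_lie_algebra_family[OF p] skew] par by blast
  note k_simps = koszul_def bracket_of_def diag_ip_def E_nth
  show ?thesis
  proof (cases p)
    case (R_E2 t)
    then have ip: "ip ?M = diag_ip t t t t" and t: "t > 0" using p by auto
    have "H (E 1) $ 4 = 0" "H (E 1) $ 3 = 0" "H (E 2) $ 4 = 0" "H (E 2) $ 3 = 0"
      using k[of 1 1 3] k[of 1 1 4] k[of 1 2 3] k[of 1 2 4] t
      by (simp_all add: R_E2 k_simps)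
    then show ?thesis using H_ab_of_block[OF skew ip t t] R_E2 by auto
  next
    case (RR_Aff t)
    then have ip: "ip ?M = diag_ip t t t t" and t: "t > 0" using p by auto
    have "H (E 1) $ 4 = 0" "H (E 1) $ 3 = 0" "H (E 2) $ 4 = 0" "H (E 2) $ 3 = 0"
      using k[of 4 1 3] k[of 4 1 4] k[of 4 2 3] k[of 4 2 4] t
      by (simp_all add: RR_Aff k_simps)
    then show ?thesis using H_ab_of_block[OF skew ip t t] RR_Aff by auto
  next
    case (R4' l t)
    then have ip: "ip ?M = diag_ip t t t t" and t: "t > 0" "l > 0" using p by auto
    have "H (E 1) $ 4 = 0" "H (E 1) $ 3 = 0" "H (E 2) $ 4 = 0" "H (E 2) $ 3 = 0"
      using k[of 1 1 3] k[of 1 1 4] k[of 1 2 3] k[of 1 2 4] t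
      by (simp_all add: R4' k_simps)
    then show ?thesis using H_ab_of_block[OF skew ip t(1,1)] R4' by auto
  next
    case (Aff_Aff t s)
    then have ip: "ip ?M = diag_ip t t (t * s) (t * s)" and t: "t > 0" "s > 0" "t * s > 0"
      using p by auto
    have "H (E 2) $ 3 = 0" "H (E 2) $ 4 = 0" "H (E 1) $ 3 = 0" "H (E 1) $ 4 = 0"
      using k[of 2 1 3] k[of 2 1 4] k[of 2 2 3] k[of 2 2 4] t skew_coords[OF skew ip t(1,3)]
      by (simp_all add: Aff_Aff k_simps)
    then show ?thesis using H_ab_of_block[OF skew ip t(1,3)] Aff_Aff by auto
  next
    case (D4_half t)
    then have ip: "ip ?M = diag_ip t t t t" and t: "t > 0" using p by auto
    have s: "H (E 3) $ 1 = - H (E 1) $ 3" "H (E 4) $ 1 = - H (E 1) $ 4"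
      "H (E 3) $ 2 = - H (E 2) $ 3" "H (E 4) $ 2 = - H (E 2) $ 4"
      using skew_coords(7-10)[OF skew ip t t] t by (simp_all add: mult_eq_minus_mult_iff)
    note s = s skew_coords(1-6)[OF skew ip t t]
    have "H (E 1) $ 3 = H (E 2) $ 4" "H (E 1) $ 2 = - H (E 3) $ 4" "H (E 1) $ 4 = - H (E 2) $ 3"
       "2 * H (E 1) $ 4 = H (E 2) $ 3" "2 * H (E 1) $ 3 = - H (E 2) $ 4"
      using k[of 1 1 2] k[of 1 1 3] k[of 2 1 2] k[of 3 1 3] k[of 3 1 4] t
      by (simp_all add: D4_half k_simps s mult_eq_minus_mult_iff)
    then show ?thesis using K_12_of_coords[OF skew ip t t] D4_half by auto
  next
    case (D4_two t)
    then have ip: "ip ?M = diag_ip t t t t" and t: "t > 0" using p by auto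
    have s: "H (E 3) $ 1 = - H (E 1) $ 3" "H (E 4) $ 1 = - H (E 1) $ 4"
      "H (E 3) $ 2 = - H (E 2) $ 3" "H (E 4) $ 2 = - H (E 2) $ 4"
      using skew_coords(7-10)[OF skew ip t t] t by (simp_all add: mult_eq_minus_mult_iff)
    note s = s skew_coords(1-6)[OF skew ip t t]
    have "H (E 1) $ 3 = 2 * H (E 2) $ 4" "H (E 1) $ 2 = - 2 * H (E 3) $ 4"
       "2 * H (E 1) $ 2 = - H (E 3) $ 4" "2 * H (E 1) $ 3 = H (E 2) $ 4" "H (E 2) $ 3 = H (E 1) $ 4"
      using k[of 1 1 2] k[of 1 1 3] k[of 1 2 4] k[of 1 3 4] k[of 2 1 2] t
      by (simp_all add: D4_two k_simps s mult_eq_minus_mult_iff)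
    then show ?thesis using K_14_of_coords[OF skew ip t] D4_two by auto
  next
    case (D4' d t)
    then have ip: "ip ?M = diag_ip t t t t" and t: "t > 0" "d > 0" using p by auto
    have s: "H (E 3) $ 1 = - H (E 1) $ 3" "H (E 4) $ 1 = - H (E 1) $ 4"
      "H (E 3) $ 2 = - H (E 2) $ 3" "H (E 4) $ 2 = - H (E 2) $ 4"
      using skew_coords(7-10)[OF skew ip t(1,1)] t by (simp_all add: mult_eq_minus_mult_iff)
    note s = s skew_coords(1-6)[OF skew ip t(1,1)]
    have "H (E 2) $ 3 = 0" "H (E 2) $ 4 = 0" "H (E 1) $ 3 = 0" "H (E 1) $ 4 = 0"
      using k[of 4 1 3] k[of 4 1 4] k[of 4 2 3] k[of 4 2 4] t
      by (simp_all add: D4' k_simps s algebra_simps)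
    moreover have "H (E 3) $ 4 = - H (E 1) $ 2" using k[of 1 1 3] t by (simp add: D4' k_simps s mult_eq_minus_mult_iff)
    ultimately show ?thesis using K_12_of_coords[OF skew ip t(1,1)] D4' by auto
  qed
qed


section \<open>Equivalences between listed endomorphisms\<close>

lemma linear_endo_of: "linear (endo_of v w x y)"
  by (rule linearI) (simp_all add: endo_of_def algebra_simps)

lemma linear_listed: "linear (H_ab a b)" "linear (K_12 c)" "linear (K_14 c)"
  by (simp_all add: H_ab_def K_12_def K_14_def linear_endo_of)

lemma endo_equivI:
  assumes "linear \<phi>" "\<And>x. \<psi> (\<phi> x) = x" "\<And>x. \<phi> (\<psi> x) = x"
    and "\<And>x y. \<phi> (br M x y) = br M (\<phi> x) (\<phi> y)" "\<And>x y. ip M (\<phi> x) (\<phi> y) = ip M x y"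
    and "\<And>x. \<phi> (H x) = K (\<phi> x)"
  shows "endo_equiv M H K"
proof -
  have "bij \<phi>" using assms(2,3) by (intro o_bij[of \<psi>]) (auto simp: fun_eq_iff)
  then show ?thesis using assms unfolding endo_equiv_def isometric_iso_def
    by (intro exI[of _ \<phi>]) (auto simp: fun_eq_iff)
qed

text \<open>The automorphisms behind the sign and ordering conditions in the list.\<close>

lemma
  fixes \<alpha> \<beta> :: real
  assumes "\<alpha> = 1 \<or> \<alpha> = -1" "\<beta> = 1 \<or> \<beta> = -1"
  shows equiv_R_E2: "endo_equiv (family_algebra (R_E2 t)) (H_ab a b) (H_ab (\<alpha> * a) (\<beta> * b))"
    and equiv_RR_Aff: "endo_equiv (family_algebra (RR_Aff t)) (H_ab a b) (H_ab (\<alpha> * a) (\<beta> * b))"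
    and equiv_R4': "endo_equiv (family_algebra (R4' l t)) (H_ab a b) (H_ab (\<alpha> * a) b)"
    and equiv_Aff_Aff: "endo_equiv (family_algebra (Aff_Aff t s)) (H_ab a b) (H_ab (\<alpha> * a) (\<beta> * b))"
    and equiv_Aff_Aff_swap: "endo_equiv (family_algebra (Aff_Aff t 1)) (H_ab a b) (H_ab (\<beta> * b) (\<alpha> * a))"
    and equiv_D4_half: "endo_equiv (family_algebra (D4_half t)) (K_12 c) (K_12 (\<alpha> * c))"
    and equiv_D4_two: "endo_equiv (family_algebra (D4_two t)) (K_14 c) (K_14 (\<alpha> * c))"
proof -
  note defs = endo_of_def bracket_of_def diag_ip_def H_ab_def K_12_def K_14_def vec_eq_iff forall_4 E_nth
  let ?\<phi> = "\<lambda>\<sigma>\<^sub>1 \<sigma>\<^sub>2 \<sigma>\<^sub>3 \<sigma>\<^sub>4. endo_of (\<sigma>\<^sub>1 *\<^sub>R E 1) (\<sigma>\<^sub>2 *\<^sub>R E 2) (\<sigma>\<^sub>3 *\<^sub>R E 3) (\<sigma>\<^sub>4 *\<^sub>R E 4)"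
  show "endo_equiv (family_algebra (R_E2 t)) (H_ab a b) (H_ab (\<alpha> * a) (\<beta> * b))"
    by (rule endo_equivI[of "?\<phi> \<beta> (\<alpha> * \<beta>) \<beta> 1" "?\<phi> \<beta> (\<alpha> * \<beta>) \<beta> 1"])
      (use assms in \<open>auto simp: linear_endo_of defs\<close>)
  show "endo_equiv (family_algebra (RR_Aff t)) (H_ab a b) (H_ab (\<alpha> * a) (\<beta> * b))"
    by (rule endo_equivI[of "?\<phi> 1 \<alpha> 1 \<beta>" "?\<phi> 1 \<alpha> 1 \<beta>"])
      (use assms in \<open>auto simp: linear_endo_of defs\<close>)
  show "endo_equiv (family_algebra (R4' l t)) (H_ab a b) (H_ab (\<alpha> * a) b)"
    by (rule endo_equivI[of "?\<phi> 1 \<alpha> 1 1" "?\<phi> 1 \<alpha> 1 1"])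
      (use assms in \<open>auto simp: linear_endo_of defs\<close>)
  show "endo_equiv (family_algebra (Aff_Aff t s)) (H_ab a b) (H_ab (\<alpha> * a) (\<beta> * b))"
    by (rule endo_equivI[of "?\<phi> 1 \<alpha> 1 \<beta>" "?\<phi> 1 \<alpha> 1 \<beta>"])
      (use assms in \<open>auto simp: linear_endo_of defs\<close>)
  show "endo_equiv (family_algebra (Aff_Aff t 1)) (H_ab a b) (H_ab (\<beta> * b) (\<alpha> * a))"
    by (rule endo_equivI[of "endo_of (E 3) (\<alpha> *\<^sub>R E 4) (E 1) (\<beta> *\<^sub>R E 2)"
          "endo_of (E 3) (\<beta> *\<^sub>R E 4) (E 1) (\<alpha> *\<^sub>R E 2)"])
      (use assms in \<open>auto simp: linear_endo_of defs\<close>)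
  show "endo_equiv (family_algebra (D4_half t)) (K_12 c) (K_12 (\<alpha> * c))"
    by (rule endo_equivI[of "?\<phi> 1 \<alpha> \<alpha> 1" "?\<phi> 1 \<alpha> \<alpha> 1"])
      (use assms in \<open>auto simp: linear_endo_of defs\<close>)
  show "endo_equiv (family_algebra (D4_two t)) (K_14 c) (K_14 (\<alpha> * c))"
    by (rule endo_equivI[of "?\<phi> \<alpha> \<alpha> 1 1" "?\<phi> \<alpha> \<alpha> 1 1"])
      (use assms in \<open>auto simp: linear_endo_of defs\<close>)
qed

lemma obtain_sign:
  fixes x :: real
  obtains \<alpha> where "\<alpha> = 1 \<or> \<alpha> = -1" "\<alpha> * x = \<bar>x\<bar>"
  by (cases "x \<ge> 0") (use that[of 1] that[of "-1"] in auto)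

lemma listed_endosI:
  "0 \<le> a \<Longrightarrow> 0 \<le> b \<Longrightarrow> H_ab a b \<in> listed_endos (R_E2 t)"
  "0 \<le> a \<Longrightarrow> 0 \<le> b \<Longrightarrow> H_ab a b \<in> listed_endos (RR_Aff t)"
  "0 \<le> a \<Longrightarrow> H_ab a b \<in> listed_endos (R4' l t)"
  "0 \<le> a \<Longrightarrow> 0 \<le> b \<Longrightarrow> s < 1 \<or> b \<le> a \<Longrightarrow> H_ab a b \<in> listed_endos (Aff_Aff t s)"
  "0 < c \<Longrightarrow> K_12 c \<in> listed_endos (D4_half t)"
  "0 < c \<Longrightarrow> K_14 c \<in> listed_endos (D4_two t)"
  by auto

lemma normal_form_exists:
  assumes p: "admissible p" and nz: "H \<noteq> (\<lambda>x. 0)"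
    and skew: "skew_symmetric (family_algebra p) H" and par: "parallel (family_algebra p) H"
  shows "\<exists>K\<in>listed_endos p. endo_equiv (family_algebra p) H K"
proof -
  have K0: "K_12 0 = (\<lambda>x. 0)" "K_14 0 = (\<lambda>x. 0)"
    by (auto simp: K_12_def K_14_def endo_of_def)
  note form = parallel_form[OF p skew par]
  show ?thesis
  proof (cases p)
    case (R_E2 t)
    then obtain a b where H: "H = H_ab a b" using form by auto
    obtain \<alpha> where \<alpha>: "\<alpha> = 1 \<or> \<alpha> = -1" "\<alpha> * a = \<bar>a\<bar>" by (rule obtain_sign)
    obtain \<beta> where \<beta>: "\<beta> = 1 \<or> \<beta> = -1" "\<beta> * b = \<bar>b\<bar>" by (rule obtain_sign)
    show ?thesis
      using equiv_R_E2[OF \<alpha>(1) \<beta>(1), of t a b]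
      by (intro bexI[of _ "H_ab \<bar>a\<bar> \<bar>b\<bar>"]) (simp_all del: listed_endos.simps add: listed_endosI R_E2 H \<alpha>(2) \<beta>(2))
  next
    case (RR_Aff t)
    then obtain a b where H: "H = H_ab a b" using form by auto
    obtain \<alpha> where \<alpha>: "\<alpha> = 1 \<or> \<alpha> = -1" "\<alpha> * a = \<bar>a\<bar>" by (rule obtain_sign)
    obtain \<beta> where \<beta>: "\<beta> = 1 \<or> \<beta> = -1" "\<beta> * b = \<bar>b\<bar>" by (rule obtain_sign)
    show ?thesis
      using equiv_RR_Aff[OF \<alpha>(1) \<beta>(1), of t a b]
      by (intro bexI[of _ "H_ab \<bar>a\<bar> \<bar>b\<bar>"]) (simp_all del: listed_endos.simps add: listed_endosI RR_Aff H \<alpha>(2) \<beta>(2))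
  next
    case (R4' l t)
    then obtain a b where H: "H = H_ab a b" using form by auto
    obtain \<alpha> where \<alpha>: "\<alpha> = 1 \<or> \<alpha> = -1" "\<alpha> * a = \<bar>a\<bar>" by (rule obtain_sign)
    show ?thesis
      using equiv_R4'[OF \<alpha>(1) \<alpha>(1), of l t a b]
      by (intro bexI[of _ "H_ab \<bar>a\<bar> b"]) (simp_all del: listed_endos.simps add: listed_endosI R4' H \<alpha>(2))
  next
    case (Aff_Aff t s)
    then obtain a b where H: "H = H_ab a b" using form by auto
    obtain \<alpha> where \<alpha>: "\<alpha> = 1 \<or> \<alpha> = -1" "\<alpha> * a = \<bar>a\<bar>" by (rule obtain_sign)
    obtain \<beta> where \<beta>: "\<beta> = 1 \<or> \<beta> = -1" "\<beta> * b = \<bar>b\<bar>" by (rule obtain_sign)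
    show ?thesis
    proof (cases "s < 1 \<or> \<bar>b\<bar> \<le> \<bar>a\<bar>")
      case True
      then have "H_ab \<bar>a\<bar> \<bar>b\<bar> \<in> listed_endos p"
        unfolding Aff_Aff by (intro listed_endosI) auto
      then show ?thesis
        by (rule bexI[rotated])
          (use equiv_Aff_Aff[OF \<alpha>(1) \<beta>(1), of t s a b] in \<open>simp add: Aff_Aff H \<alpha>(2) \<beta>(2)\<close>)
    next
      case False
      then have "s = 1" using p by (auto simp: Aff_Aff)
      moreover have "H_ab \<bar>b\<bar> \<bar>a\<bar> \<in> listed_endos p"
        using False unfolding Aff_Aff by (intro listed_endosI) auto
      moreover have "endo_equiv (family_algebra p) H (H_ab \<bar>b\<bar> \<bar>a\<bar>)"
        using equiv_Aff_Aff_swap[OF \<alpha>(1) \<beta>(1), of t a b] \<open>s = 1\<close>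
        by (simp add: Aff_Aff H \<alpha>(2) \<beta>(2))
      ultimately show ?thesis by blast
    qed
  next
    case (D4_half t)
    then obtain c where H: "H = K_12 c" using form by auto
    obtain \<alpha> where \<alpha>: "\<alpha> = 1 \<or> \<alpha> = -1" "\<alpha> * c = \<bar>c\<bar>" by (rule obtain_sign)
    have "c \<noteq> 0" using nz K0 H by auto
    then show ?thesis
      using equiv_D4_half[OF \<alpha>(1) \<alpha>(1), of t c]
      by (intro bexI[of _ "K_12 \<bar>c\<bar>"]) (simp_all del: listed_endos.simps add: listed_endosI D4_half H \<alpha>(2))
  next
    case (D4_two t)
    then obtain c where H: "H = K_14 c" using form by auto
    obtain \<alpha> where \<alpha>: "\<alpha> = 1 \<or> \<alpha> = -1" "\<alpha> * c = \<bar>c\<bar>" by (rule obtain_sign)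
    have "c \<noteq> 0" using nz K0 H by auto
    then show ?thesis
      using equiv_D4_two[OF \<alpha>(1) \<alpha>(1), of t c]
      by (intro bexI[of _ "K_14 \<bar>c\<bar>"]) (simp_all del: listed_endos.simps add: listed_endosI D4_two H \<alpha>(2))
  next
    case (D4' d t)
    then obtain c where H: "H = K_12 c" using form by auto
    have "c \<noteq> 0" using nz K0 H by auto
    moreover have "endo_equiv M H H" for M :: "(real^4) metric_lie" and H
      by (rule endo_equivI[of id id]) (auto simp: linear_id)
    ultimately show ?thesis by (auto simp: D4' H)
  qed
qed


section \<open>Invariants of an endomorphism\<close>

lemma trace_endo_square:
  fixes M :: "(real^'n) metric_lie"
  assumes "isometric_iso M M \<phi>" "\<phi> \<circ> H = K \<circ> \<phi>" "linear H" "linear K"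
  shows "trace (matrix (H \<circ> H)) = trace (matrix (K \<circ> K))"
proof (rule trace_matrix_conj[of _ _ \<phi>])
  show "\<phi> \<circ> (H \<circ> H) = (K \<circ> K) \<circ> \<phi>" using assms(2) by (metis comp_assoc)
qed (use assms in \<open>auto simp: isometric_iso_def intro: linear_compose\<close>)

lemma trace_ad_endo:
  fixes M :: "(real^'n) metric_lie"
  assumes "metric_lie_algebra M" "isometric_iso M M \<phi>" "\<phi> \<circ> H = K \<circ> \<phi>" "linear H" "linear K"
  shows "trace (matrix (br M x \<circ> H)) = trace (matrix (br M (\<phi> x) \<circ> K))"
proof (rule trace_matrix_conj[of _ _ \<phi>])
  have "\<phi> (br M x (H y)) = br M (\<phi> x) (K (\<phi> y))" for y
    using assms(2,3) unfolding isometric_iso_def by (metis comp_apply)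
  then show "\<phi> \<circ> (br M x \<circ> H) = (br M (\<phi> x) \<circ> K) \<circ> \<phi>" by (simp add: fun_eq_iff)
qed (use assms linear_br in \<open>auto simp: isometric_iso_def intro: linear_compose\<close>)

lemma trace_square_listed:
  "trace (matrix (H_ab a b \<circ> H_ab a b)) = - 2 * (a\<^sup>2 + b\<^sup>2)"
  "trace (matrix (K_12 c \<circ> K_12 c)) = - 4 * c\<^sup>2"
  "trace (matrix (K_14 c \<circ> K_14 c)) = - 4 * c\<^sup>2"
  by (simp_all add: trace_matrix_4 H_ab_def K_12_def K_14_def endo_of_def E_nth power2_eq_square)

text \<open>
  \<open>H\<^sup>2\<close> is \<open>-a\<^sup>2\<close> on the first coordinate plane and \<open>-b\<^sup>2\<close> on the second. If \<open>\<phi>\<close> sends \<open>E 3\<close> or \<open>E 4\<close>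
  into one of the two planes, comparing eigenvalues there gives one square and \<open>tr (H\<^sup>2)\<close> the other.
\<close>

lemma H_ab_conj_image_E3_E4:
  assumes \<phi>: "isometric_iso M M \<phi>" and conj: "\<phi> \<circ> H_ab a b = H_ab a' b' \<circ> \<phi>" and k: "k = 3 \<or> k = 4"
  shows "\<phi> (E k) $ 1 = 0 \<Longrightarrow> \<phi> (E k) $ 2 = 0 \<Longrightarrow> a\<^sup>2 = a'\<^sup>2 \<and> b\<^sup>2 = b'\<^sup>2"
    and "\<phi> (E k) $ 3 = 0 \<Longrightarrow> \<phi> (E k) $ 4 = 0 \<Longrightarrow> a\<^sup>2 = b'\<^sup>2 \<and> b\<^sup>2 = a'\<^sup>2"
proof -
  let ?y = "\<phi> (E k)"
  have lin: "linear \<phi>" "inj \<phi>" using \<phi> by (auto simp: isometric_iso_def bij_def)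
  have "E k \<noteq> 0" by (simp add: axis_eq_0_iff)
  then have nz: "?y \<noteq> 0" using lin by (metis linear_injective_0)
  have sq: "H_ab a b (H_ab a b x) = endo_of (- a\<^sup>2 *\<^sub>R E 1) (- a\<^sup>2 *\<^sub>R E 2) (- b\<^sup>2 *\<^sub>R E 3) (- b\<^sup>2 *\<^sub>R E 4) x"
    for a b x
    by (simp add: H_ab_def endo_of_def vec_eq_iff forall_4 E_nth power2_eq_square)
  have "\<phi> (H_ab a b (H_ab a b (E k))) = H_ab a' b' (H_ab a' b' ?y)"
    using conj by (metis comp_apply)
  moreover have "H_ab a b (H_ab a b (E k)) = - b\<^sup>2 *\<^sub>R E k"
    using k by (auto simp: sq endo_of_def E_nth)
  ultimately have y: "- b\<^sup>2 *\<^sub>R ?y = H_ab a' b' (H_ab a' b' ?y)"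
    using lin(1) by (metis linear_scale)
  have tr: "a\<^sup>2 + b\<^sup>2 = a'\<^sup>2 + b'\<^sup>2"
    using trace_endo_square[OF \<phi> conj] by (simp add: linear_listed trace_square_listed)
  show "a\<^sup>2 = a'\<^sup>2 \<and> b\<^sup>2 = b'\<^sup>2" if "?y $ 1 = 0" "?y $ 2 = 0"
  proof -
    have "?y $ 3 \<noteq> 0 \<or> ?y $ 4 \<noteq> 0" using nz that by (simp add: vec_eq_iff forall_4)
    then have "b\<^sup>2 = b'\<^sup>2" using y by (auto simp: sq endo_of_def vec_eq_iff forall_4 E_nth)
    then show ?thesis using tr by simp
  qed
  show "a\<^sup>2 = b'\<^sup>2 \<and> b\<^sup>2 = a'\<^sup>2" if "?y $ 3 = 0" "?y $ 4 = 0"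
  proof -
    have "?y $ 1 \<noteq> 0 \<or> ?y $ 2 \<noteq> 0" using nz that by (simp add: vec_eq_iff forall_4)
    then have "b\<^sup>2 = a'\<^sup>2" using y by (auto simp: sq endo_of_def vec_eq_iff forall_4 E_nth)
    then show ?thesis using tr by simp
  qed
qed

lemma unit_basis_fixed:
  assumes "t > 0" "diag_ip t t t t y y = t" "y $ i = 1"
  shows "y = E i"
proof -
  have "(y$1)\<^sup>2 + (y$2)\<^sup>2 + (y$3)\<^sup>2 + (y$4)\<^sup>2 = 1"
  proof -
    have "t * ((y$1)\<^sup>2 + (y$2)\<^sup>2 + (y$3)\<^sup>2 + (y$4)\<^sup>2) = t * 1"
      using assms(2) by (simp add: diag_ip_def power2_eq_square algebra_simps)
    then show ?thesis using assms(1) by simp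
  qed
  moreover have "(y$j)\<^sup>2 \<ge> 0" for j by simp
  ultimately have "\<And>j. j \<noteq> i \<Longrightarrow> (y$j)\<^sup>2 = 0"
    using assms(3) exhaust_4[of i] by (smt (verit) exhaust_4 one_power2)
  then show ?thesis using assms(3) by (auto simp: vec_eq_iff E_nth)
qed

text \<open>\<open>E 4\<close> is a bracket, so its image lies in the derived algebra, inside the plane \<open>(E 3, E 4)\<close>.
  The same argument applies to \<open>\<real>\<^sup>2 \<times> \<aa>\<ff>\<ff>(\<real>)\<close>.\<close>

lemma equiv_R_E2_values:
  assumes "endo_equiv (family_algebra (R_E2 t)) (H_ab a b) (H_ab a' b')"
  shows "a\<^sup>2 = a'\<^sup>2 \<and> b\<^sup>2 = b'\<^sup>2"
proof -
  let ?M = "family_algebra (R_E2 t)"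
  obtain \<phi> where \<phi>: "isometric_iso ?M ?M \<phi>" "\<phi> \<circ> H_ab a b = H_ab a' b' \<circ> \<phi>"
    using assms by (auto simp: endo_equiv_def)
  have "\<phi> (br ?M (E 3) (E 1)) = br ?M (\<phi> (E 3)) (\<phi> (E 1))"
    using \<phi>(1) unfolding isometric_iso_def by blast
  moreover have "br ?M (E 3) (E 1) = E 4" by (simp add: bracket_of_def E_nth)
  ultimately have "\<phi> (E 4) $ 1 = 0" "\<phi> (E 4) $ 2 = 0" by (simp_all add: bracket_of_def E_nth)
  then show ?thesis using H_ab_conj_image_E3_E4(1)[OF \<phi>, of 4] by simp
qed

lemma equiv_RR_Aff_values:
  assumes "endo_equiv (family_algebra (RR_Aff t)) (H_ab a b) (H_ab a' b')"
  shows "a\<^sup>2 = a'\<^sup>2 \<and> b\<^sup>2 = b'\<^sup>2"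
proof -
  let ?M = "family_algebra (RR_Aff t)"
  obtain \<phi> where \<phi>: "isometric_iso ?M ?M \<phi>" "\<phi> \<circ> H_ab a b = H_ab a' b' \<circ> \<phi>"
    using assms by (auto simp: endo_equiv_def)
  have "\<phi> (br ?M (E 3) (E 4)) = br ?M (\<phi> (E 3)) (\<phi> (E 4))"
    using \<phi>(1) unfolding isometric_iso_def by blast
  moreover have "br ?M (E 3) (E 4) = E 4" by (simp add: bracket_of_def E_nth)
  ultimately have y: "\<phi> (E 4) = br ?M (\<phi> (E 3)) (\<phi> (E 4))" by simp
  have "br ?M u v $ 1 = 0" "br ?M u v $ 2 = 0" for u v by (simp_all add: bracket_of_def E_nth)
  then have "\<phi> (E 4) $ 1 = 0" "\<phi> (E 4) $ 2 = 0" using y by metis+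
  then show ?thesis using H_ab_conj_image_E3_E4(1)[OF \<phi>, of 4] by simp
qed

text \<open>An automorphism fixes \<open>E 1\<close>, and \<open>tr (ad (E 1) \<circ> H_ab a b) = 2 b\<close> recovers the sign of \<open>b\<close>.\<close>

lemma equiv_R4'_values:
  assumes "l > 0" "t > 0" and "endo_equiv (family_algebra (R4' l t)) (H_ab a b) (H_ab a' b')"
  shows "a\<^sup>2 = a'\<^sup>2 \<and> b = b'"
proof -
  let ?M = "family_algebra (R4' l t)"
  have M: "metric_lie_algebra ?M" using assms by (intro metric_lie_algebra_family) simp
  obtain \<phi> where \<phi>: "isometric_iso ?M ?M \<phi>" "\<phi> \<circ> H_ab a b = H_ab a' b' \<circ> \<phi>"
    using assms(3) by (auto simp: endo_equiv_def)
  have "\<phi> (E 1) $ 1 = 1"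
    using tau_iso[OF M M \<phi>(1), of "E 1"] assms by (simp add: tau_kil_family E_nth)
  moreover have "ip ?M (\<phi> (E 1)) (\<phi> (E 1)) = ip ?M (E 1) (E 1)"
    using \<phi>(1) unfolding isometric_iso_def by blast
  ultimately have "\<phi> (E 1) = E 1"
    using assms by (intro unit_basis_fixed[of t]) (simp_all add: diag_ip_def E_nth)
  then have "b = b'"
    using trace_ad_endo[OF M \<phi> linear_listed(1) linear_listed(1), of "E 1"]
    by (simp add: trace_matrix_4 H_ab_def endo_of_def bracket_of_def E_nth)
  moreover have "a\<^sup>2 + b\<^sup>2 = a'\<^sup>2 + b'\<^sup>2"
    using trace_endo_square[OF \<phi>] by (simp add: linear_listed trace_square_listed)
  ultimately show ?thesis by simp
qed

text \<open>
  The values of \<open>tau\<close> and \<open>kil\<close> at \<open>\<phi> (E 3)\<close> force its \<open>e\<^sub>1\<close>- and \<open>e\<^sub>2\<close>-coordinates to be \<open>(0, 1)\<close> or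
  \<open>(1, 0)\<close>; its length \<open>t s\<close> then forces the remaining coordinates to vanish, and the second case to
  have \<open>s = 1\<close>.
\<close>

lemma equiv_Aff_Aff_values:
  assumes "t > 0" "s > 0" "s \<le> 1"
    and "endo_equiv (family_algebra (Aff_Aff t s)) (H_ab a b) (H_ab a' b')"
  shows "a\<^sup>2 = a'\<^sup>2 \<and> b\<^sup>2 = b'\<^sup>2 \<or> s = 1 \<and> a\<^sup>2 = b'\<^sup>2 \<and> b\<^sup>2 = a'\<^sup>2"
proof -
  let ?M = "family_algebra (Aff_Aff t s)"
  have M: "metric_lie_algebra ?M" using assms by (intro metric_lie_algebra_family) simp
  obtain \<phi> where \<phi>: "isometric_iso ?M ?M \<phi>" "\<phi> \<circ> H_ab a b = H_ab a' b' \<circ> \<phi>"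
    using assms(4) by (auto simp: endo_equiv_def)
  let ?y = "\<phi> (E 3)"
  have 1: "?y$1 + ?y$3 = 1" "(?y$1)\<^sup>2 + (?y$3)\<^sup>2 = 1"
    using tau_iso[OF M M \<phi>(1), of "E 3"] kil_iso[OF M M \<phi>(1), of "E 3"]
    by (simp_all add: tau_kil_family E_nth)
  have "ip ?M ?y ?y = ip ?M (E 3) (E 3)"
    using \<phi>(1) unfolding isometric_iso_def by blast
  then have "t * ((?y$1)\<^sup>2 + (?y$2)\<^sup>2 + s * (?y$3)\<^sup>2 + s * (?y$4)\<^sup>2) = t * s"
    by (simp add: diag_ip_def E_nth power2_eq_square algebra_simps)
  then have 2: "(?y$1)\<^sup>2 + (?y$2)\<^sup>2 + s * (?y$3)\<^sup>2 + s * (?y$4)\<^sup>2 = s"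
    using assms(1) by simp
  have "?y$3 = 1 - ?y$1" using 1(1) by simp
  then have "(?y$1)\<^sup>2 + (1 - ?y$1)\<^sup>2 = 1" using 1(2) by metis
  then have "2 * (?y$1 * (1 - ?y$1)) = 0" by (simp add: power2_eq_square algebra_simps)
  then consider "?y$1 = 0" "?y$3 = 1" | "?y$1 = 1" "?y$3 = 0" using 1(1) by auto
  then show ?thesis
  proof cases
    case 1
    then have "?y$2 = 0" using 2 assms(2)
      by (simp add: add_nonneg_eq_0_iff)
    then show ?thesis using H_ab_conj_image_E3_E4(1)[OF \<phi>, of 3] 1 by simp
  next
    case 2
    have eq: "1 + (?y$2)\<^sup>2 + s * (?y$4)\<^sup>2 = s"
      using \<open>(?y$1)\<^sup>2 + (?y$2)\<^sup>2 + s * (?y$3)\<^sup>2 + s * (?y$4)\<^sup>2 = s\<close> 2 by simp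
    have nn: "(?y$2)\<^sup>2 \<ge> 0" "s * (?y$4)\<^sup>2 \<ge> 0" using assms(2) by simp_all
    then have "s = 1" "s * (?y$4)\<^sup>2 = 0" using eq assms(3) by linarith+
    then show ?thesis using H_ab_conj_image_E3_E4(2)[OF \<phi>, of 3] 2 by simp
  qed
qed

lemma equiv_K_values:
  shows "endo_equiv M (K_12 c) (K_12 c') \<Longrightarrow> c\<^sup>2 = c'\<^sup>2"
    and "endo_equiv M (K_14 c) (K_14 c') \<Longrightarrow> c\<^sup>2 = c'\<^sup>2"
  by (auto simp: endo_equiv_def linear_listed trace_square_listed dest!: trace_endo_square)

text \<open>An automorphism fixes \<open>E 4\<close>, and \<open>tr (ad (E 4) \<circ> K_12 c) = 2 c / \<delta>\<close> recovers \<open>c\<close> with its sign.\<close>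

lemma equiv_D4'_values:
  assumes "d > 0" "t > 0" and "endo_equiv (family_algebra (D4' d t)) (K_12 c) (K_12 c')"
  shows "c = c'"
proof -
  let ?M = "family_algebra (D4' d t)"
  have M: "metric_lie_algebra ?M" using assms by (intro metric_lie_algebra_family) simp
  obtain \<phi> where \<phi>: "isometric_iso ?M ?M \<phi>" "\<phi> \<circ> K_12 c = K_12 c' \<circ> \<phi>"
    using assms(3) by (auto simp: endo_equiv_def)
  have "\<phi> (E 4) $ 4 = 1"
    using tau_iso[OF M M \<phi>(1), of "E 4"] by (simp add: tau_kil_family E_nth)
  moreover have "ip ?M (\<phi> (E 4)) (\<phi> (E 4)) = ip ?M (E 4) (E 4)"
    using \<phi>(1) unfolding isometric_iso_def by blast
  ultimately have "\<phi> (E 4) = E 4"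
    using assms by (intro unit_basis_fixed[of t]) (simp_all add: diag_ip_def E_nth)
  then show ?thesis
    using trace_ad_endo[OF M \<phi> linear_listed(2) linear_listed(2), of "E 4"] assms(1)
    by (simp add: trace_matrix_4 K_12_def endo_of_def bracket_of_def E_nth)
qed


section \<open>Uniqueness of the normal form\<close>

lemma normal_form_unique:
  assumes p: "admissible p"
    and skew: "skew_symmetric (family_algebra p) H" and par: "parallel (family_algebra p) H"
    and K: "K \<in> listed_endos p" "endo_equiv (family_algebra p) H K"
    and L: "L \<in> listed_endos p" "endo_equiv (family_algebra p) H L"
  shows "K = L"
proof -
  have sq: "x = y" if "x\<^sup>2 = y\<^sup>2" "x \<ge> 0" "y \<ge> 0" for x y :: real
    using that by (simp add: power2_eq_iff_nonneg)
  note form = parallel_form[OF p skew par]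
  show ?thesis
  proof (cases p)
    case (R_E2 t)
    then obtain a b where H: "H = H_ab a b" using form by auto
    obtain k\<^sub>1 k\<^sub>2 l\<^sub>1 l\<^sub>2 where KL: "K = H_ab k\<^sub>1 k\<^sub>2" "L = H_ab l\<^sub>1 l\<^sub>2"
      and nn: "0 \<le> k\<^sub>1" "0 \<le> l\<^sub>1" "0 \<le> k\<^sub>2" "0 \<le> l\<^sub>2"
      using K(1) L(1) by (auto simp: R_E2)
    have "k\<^sub>1\<^sup>2 = l\<^sub>1\<^sup>2" "k\<^sub>2\<^sup>2 = l\<^sub>2\<^sup>2"
      using equiv_R_E2_values[of t a b k\<^sub>1 k\<^sub>2] equiv_R_E2_values[of t a b l\<^sub>1 l\<^sub>2] K(2) L(2) p
      by (simp_all add: R_E2 H KL)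
    then show ?thesis using sq nn KL by blast
  next
    case (RR_Aff t)
    then obtain a b where H: "H = H_ab a b" using form by auto
    obtain k\<^sub>1 k\<^sub>2 l\<^sub>1 l\<^sub>2 where KL: "K = H_ab k\<^sub>1 k\<^sub>2" "L = H_ab l\<^sub>1 l\<^sub>2"
      and nn: "0 \<le> k\<^sub>1" "0 \<le> l\<^sub>1" "0 \<le> k\<^sub>2" "0 \<le> l\<^sub>2"
      using K(1) L(1) by (auto simp: RR_Aff)
    have "k\<^sub>1\<^sup>2 = l\<^sub>1\<^sup>2" "k\<^sub>2\<^sup>2 = l\<^sub>2\<^sup>2"
      using equiv_RR_Aff_values[of t a b k\<^sub>1 k\<^sub>2] equiv_RR_Aff_values[of t a b l\<^sub>1 l\<^sub>2] K(2) L(2) p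
      by (simp_all add: RR_Aff H KL)
    then show ?thesis using sq nn KL by blast
  next
    case (R4' l t)
    then obtain a b where H: "H = H_ab a b" using form by auto
    obtain k\<^sub>1 k\<^sub>2 l\<^sub>1 l\<^sub>2 where KL: "K = H_ab k\<^sub>1 k\<^sub>2" "L = H_ab l\<^sub>1 l\<^sub>2"
      and nn: "0 \<le> k\<^sub>1" "0 \<le> l\<^sub>1"
      using K(1) L(1) by (auto simp: R4')
    have "k\<^sub>1\<^sup>2 = l\<^sub>1\<^sup>2" "k\<^sub>2 = l\<^sub>2"
      using equiv_R4'_values[of l t a b k\<^sub>1 k\<^sub>2] equiv_R4'_values[of l t a b l\<^sub>1 l\<^sub>2] K(2) L(2) p
      by (simp_all add: R4' H KL)
    then show ?thesis using sq nn KL by blast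
  next
    case (Aff_Aff t s)
    then obtain a b where H: "H = H_ab a b" using form by auto
    obtain k\<^sub>1 k\<^sub>2 l\<^sub>1 l\<^sub>2 where KL: "K = H_ab k\<^sub>1 k\<^sub>2" "L = H_ab l\<^sub>1 l\<^sub>2"
      and nn: "0 \<le> k\<^sub>1" "0 \<le> k\<^sub>2" "0 \<le> l\<^sub>1" "0 \<le> l\<^sub>2" and ord: "s = 1 \<Longrightarrow> k\<^sub>2 \<le> k\<^sub>1 \<and> l\<^sub>2 \<le> l\<^sub>1"
      using K(1) L(1) p by (auto simp: Aff_Aff split: if_splits)
    have "k\<^sub>1\<^sup>2 = l\<^sub>1\<^sup>2 \<and> k\<^sub>2\<^sup>2 = l\<^sub>2\<^sup>2 \<or> s = 1 \<and> k\<^sub>1\<^sup>2 = l\<^sub>2\<^sup>2 \<and> k\<^sub>2\<^sup>2 = l\<^sub>1\<^sup>2"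
      using equiv_Aff_Aff_values[of t s a b k\<^sub>1 k\<^sub>2] equiv_Aff_Aff_values[of t s a b l\<^sub>1 l\<^sub>2] K(2) L(2) p
      by (auto simp: Aff_Aff H KL)
    then have "k\<^sub>1 = l\<^sub>1 \<and> k\<^sub>2 = l\<^sub>2 \<or> s = 1 \<and> k\<^sub>1 = l\<^sub>2 \<and> k\<^sub>2 = l\<^sub>1"
      using sq nn by blast
    \<comment> \<open>For \<open>s = 1\<close> an exchange of two ordered pairs makes all four numbers equal.\<close>
    then show ?thesis using ord KL by force
  next
    case (D4_half t)
    then obtain c where H: "H = K_12 c" using form by auto
    obtain k l where KL: "K = K_12 k" "L = K_12 l" and pos: "0 \<le> k" "0 \<le> l"
      using K(1) L(1) by (auto simp: D4_half)
    have "k\<^sup>2 = l\<^sup>2"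
      using equiv_K_values(1)[of _ c k] equiv_K_values(1)[of _ c l] K(2) L(2) by (simp add: H KL)
    then show ?thesis using sq pos KL by blast
  next
    case (D4_two t)
    then obtain c where H: "H = K_14 c" using form by auto
    obtain k l where KL: "K = K_14 k" "L = K_14 l" and pos: "0 \<le> k" "0 \<le> l"
      using K(1) L(1) by (auto simp: D4_two)
    have "k\<^sup>2 = l\<^sup>2"
      using equiv_K_values(2)[of _ c k] equiv_K_values(2)[of _ c l] K(2) L(2) by (simp add: H KL)
    then show ?thesis using sq pos KL by blast
  next
    case (D4' d t)
    then obtain c where H: "H = K_12 c" using form by auto
    show ?thesis using K L p equiv_D4'_values[of d t c] by (auto simp: D4' H)
  qed
qed

theorem proposition3p6:
  shows "(\<forall>p q. admissible p \<and> admissible q \<and> p \<noteq> q \<longrightarrow>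
            \<not> metric_lie_equiv (family_algebra p) (family_algebra q))
       \<and> (\<forall>p H. admissible p \<and> H \<noteq> (\<lambda>x. 0) \<and>
            skew_symmetric (family_algebra p) H \<and> parallel (family_algebra p) H \<longrightarrow>
            (\<exists>!K. K \<in> listed_endos p \<and> endo_equiv (family_algebra p) H K))"
proof (intro conjI allI impI)
  show "\<not> metric_lie_equiv (family_algebra p) (family_algebra q)"
    if "admissible p \<and> admissible q \<and> p \<noteq> q" for p q
    using that families_non_equivalent by blast
  show "\<exists>!K. K \<in> listed_endos p \<and> endo_equiv (family_algebra p) H K"
    if "admissible p \<and> H \<noteq> (\<lambda>x. 0) \<and>
      skew_symmetric (family_algebra p) H \<and> parallel (family_algebra p) H" for p H
    using that normal_form_exists[of p H] normal_form_unique[of p H] by blast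
qed

end
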